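(* Let $p$ be a prime number and let $n$ be an integer with $n \ge 2p-1$. If $M$ is an $n$-spike that is representable over $GF(p)$, then $M$ is representable only over fields of characteristic $p$. Moreover, $M$ is uniquely representable over $GF(p)$.
   Context: For an integer $n\ge 3$, a matroid $M$ is an $n$-spike (with tip $t$) if (i) its ground set is the union of $n$ lines $L_1,\dots,L_n$, each having exactly three points and all passing through a common point $t$; (ii) $r(L_1\cup\cdots\cup L_k)=k+1$ for all $k\in\{1,\dots,n-1\}$; and (iii) $r(L_1\cup\cdots\cup L_n)=n$. A matroid $M$ is uniquely representable over a field $F$ if any two $F$-representations of $M$ (matrices over $F$ whose column matroids equal $M$, with the same labeling of columns by elements of $M$) are equivalent, i.e. one can be obtained from the other by elementary row operations, nonzero scaling of rows and columns, and applying a field automorphism of $F$ to all entries.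
   Formalization: Condition (ii) is required for every k of the n lines, not only for L_1,...,L_k in one fixed order; with a fixed order the claim fails, e.g. for p=3 and the parallel connection at the tip of P7 with n-3 ≥ 2 three-point lines. *)

theory Defs
  imports
    "Jordan_Normal_Form.VS_Connect"
    "Jordan_Normal_Form.Gauss_Jordan_Elimination"
    "Jordan_Normal_Form.Column_Operations"
    "HOL-Computational_Algebra.Computational_Algebra"
    "HOL-Library.Cardinality"
begin

section \<open>Matroids\<close>

locale matroid =
  fixes E :: "'e set" and indep :: "'e set \<Rightarrow> bool"
  assumes finite_ground: "finite E"
    and indep_subset_ground: "indep X \<Longrightarrow> X \<subseteq> E"
    and indep_empty: "indep {}"
    and indep_mono: "indep X \<Longrightarrow> Y \<subseteq> X \<Longrightarrow> indep Y"
    and indep_augment: "indep X \<Longrightarrow> indep Y \<Longrightarrow> card X < card Y \<Longrightarrow>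
           \<exists>y \<in> Y - X. indep (insert y X)"

definition matroid_rank :: "('e set \<Rightarrow> bool) \<Rightarrow> 'e set \<Rightarrow> nat" where
  "matroid_rank indep X = Max (card ` {Y. Y \<subseteq> X \<and> indep Y})"

definition flat :: "'e set \<Rightarrow> ('e set \<Rightarrow> bool) \<Rightarrow> 'e set \<Rightarrow> bool" where
  "flat E indep F \<longleftrightarrow>
     F \<subseteq> E \<and> (\<forall>e \<in> E - F. matroid_rank indep F < matroid_rank indep (insert e F))"

text \<open>A line is a flat of rank 2. Its points are its elements, which have to be pairwise
  non-parallel non-loops; that is what the independence of the two-element subsets says.\<close>

definition three_point_line :: "'e set \<Rightarrow> ('e set \<Rightarrow> bool) \<Rightarrow> 'e set \<Rightarrow> bool" where
  "three_point_line E indep L \<longleftrightarrow>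
     flat E indep L \<and> matroid_rank indep L = 2 \<and> card L = 3 \<and>
     (\<forall>X \<subseteq> L. card X = 2 \<longrightarrow> indep X)"

text \<open>The lines of a spike are unordered, so the rank condition on \<open>L\<^sub>1, \<dots>, L\<^sub>k\<close> for
  \<open>1 \<le> k \<le> n - 1\<close> is a condition on any \<open>k\<close> of the lines. Required only for the initial
  segments of one fixed ordering it would also admit, e.g., the parallel connection at the tip
  of a 3-spike with \<open>n - 3\<close> further three-point lines.\<close>

definition spike :: "nat \<Rightarrow> 'e set \<Rightarrow> ('e set \<Rightarrow> bool) \<Rightarrow> bool" where
  "spike n E indep \<longleftrightarrow> n \<ge> 3 \<and> matroid E indep \<and>
     (\<exists>(t :: 'e) (L :: nat \<Rightarrow> 'e set).
        E = (\<Union>i \<in> {1..n}. L i) \<and>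
        (\<forall>i \<in> {1..n}. three_point_line E indep (L i) \<and> t \<in> L i) \<and>
        (\<forall>k \<in> {1..n - 1}. \<forall>I \<subseteq> {1..n}. card I = k \<longrightarrow>
           matroid_rank indep (\<Union>i \<in> I. L i) = k + 1) \<and>
        matroid_rank indep (\<Union>i \<in> {1..n}. L i) = n)"

section \<open>Representations\<close>

text \<open>Independence of a family of columns: the injectivity requirement makes two equal
  columns dependent, although they are a single element of the set of columns.\<close>

definition indep_columns :: "'f :: field mat \<Rightarrow> nat set \<Rightarrow> bool" where
  "indep_columns A J \<longleftrightarrow> inj_on (col A) J \<and>
     \<not> LinearCombinations.module.lin_dep class_ring (module_vec TYPE('f) (dim_row A)) (col A ` J)"

text \<open>Independent sets of the column matroid of \<open>A\<close>, column \<open>j\<close> being labelled by \<open>es ! j\<close>.\<close>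

definition column_matroid :: "'f :: field mat \<Rightarrow> 'e list \<Rightarrow> 'e set \<Rightarrow> bool" where
  "column_matroid A es X \<longleftrightarrow>
     (\<exists>J \<subseteq> {..<dim_col A}. X = (!) es ` J \<and> indep_columns A J)"

definition represents ::
  "'f :: field mat \<Rightarrow> 'e list \<Rightarrow> 'e set \<Rightarrow> ('e set \<Rightarrow> bool) \<Rightarrow> bool" where
  "represents A es E indep \<longleftrightarrow>
     distinct es \<and> set es = E \<and> dim_col A = length es \<and> indep = column_matroid A es"

definition representable :: "'f :: field itself \<Rightarrow> 'e set \<Rightarrow> ('e set \<Rightarrow> bool) \<Rightarrow> bool" where
  "representable _ E indep \<longleftrightarrow> (\<exists>(A :: 'f mat) es. represents A es E indep)"

inductive equivalent_mat :: "'f :: field mat \<Rightarrow> 'f mat \<Rightarrow> bool" for A where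
  refl: "equivalent_mat A A"
| swap_rows: "equivalent_mat A B \<Longrightarrow> k < dim_row B \<Longrightarrow> l < dim_row B \<Longrightarrow>
    equivalent_mat A (swaprows k l B)"
| scale_row: "equivalent_mat A B \<Longrightarrow> k < dim_row B \<Longrightarrow> a \<noteq> 0 \<Longrightarrow>
    equivalent_mat A (multrow k a B)"
| add_row: "equivalent_mat A B \<Longrightarrow> k < dim_row B \<Longrightarrow> l < dim_row B \<Longrightarrow> k \<noteq> l \<Longrightarrow>
    equivalent_mat A (addrow a k l B)"
| scale_col: "equivalent_mat A B \<Longrightarrow> j < dim_col B \<Longrightarrow> a \<noteq> 0 \<Longrightarrow>
    equivalent_mat A (multcol j a B)"
| automorphism: "equivalent_mat A B \<Longrightarrow> field_hom \<sigma> \<Longrightarrow> bij \<sigma> \<Longrightarrow>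
    equivalent_mat A (map_mat \<sigma> B)"

text \<open>The operations above preserve the number of rows, while representations of one matroid
  may differ in it by redundant rows. As usual, zero rows are immaterial: the matrix with fewer
  rows is padded with zero rows first (none are added if the sizes agree). Both matrices list
  their columns in the same order \<open>es\<close>, so no column permutations occur.\<close>

definition uniquely_representable ::
  "'f :: field itself \<Rightarrow> 'e set \<Rightarrow> ('e set \<Rightarrow> bool) \<Rightarrow> bool" where
  "uniquely_representable _ E indep \<longleftrightarrow>
     (\<forall>(A :: 'f mat) B es.
        represents A es E indep \<longrightarrow> represents B es E indep \<longrightarrow> dim_row A \<le> dim_row B \<longrightarrow>
        equivalent_mat (A @\<^sub>r 0\<^sub>m (dim_row B - dim_row A) (dim_col A)) B)"

end

theory Submission
  imports Defs "HOL-Number_Theory.Residues"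
begin

text \<open>Write the \<open>i\<close>-th line of the spike as \<open>{t, x\<^sub>i, y\<^sub>i}\<close>. After scaling, a representation
  satisfies \<open>x\<^sub>1 + \<dots> + x\<^sub>n = a t\<close> and \<open>y\<^sub>i = x\<^sub>i + b\<^sub>i t\<close> with all \<open>b\<^sub>i\<close> nonzero, and the transversal
  taking \<open>y\<^sub>i\<close> for \<open>i \<in> S\<close> and \<open>x\<^sub>i\<close> otherwise is dependent iff \<open>a + \<Sum>\<^sub>S b\<^sub>i = 0\<close>. So two
  representations, with parameters \<open>(a, b)\<close> over \<open>GF(p)\<close> and \<open>(a', b')\<close> over another field, have
  the same sets \<open>S\<close> of this kind. Any \<open>p - 1\<close> nonzero elements have all of \<open>GF(p)\<close> as subset sums.
  Hence inside a window \<open>W\<close> of \<open>p\<close> indices, coincidences of subset sums of \<open>b\<close> and of \<open>b'\<close> are the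
  same, because the \<open>n - p \<ge> p - 1\<close> outside indices can complete any sum to \<open>- a\<close>. Reaching
  multiples of \<open>b\<^sub>e\<close> by sums over \<open>W - {e}\<close> gives: a subset sum \<open>k b\<^sub>e\<close> of \<open>b\<close> corresponds to
  \<open>k b'\<^sub>e\<close>. Taking \<open>k = p\<close> yields characteristic \<open>p\<close>, and over \<open>GF(p)\<close> itself \<open>(a', b')\<close> is a
  multiple of \<open>(a, b)\<close>; the representations then agree after column scaling and row reduction with
  respect to \<open>t, x\<^sub>1, \<dots>, x\<^bsub>n-1\<^esub>\<close>.\<close>

subsection \<open>Subset sums in a prime field\<close>

lemma CHAR_eq_prime_CARD:
  assumes "prime CARD('g :: field)"
  shows "CHAR('g) = CARD('g)"
proof -
  have "CHAR('g) dvd CARD('g)" by (rule CHAR_dvd_CARD)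
  moreover have "CHAR('g) \<noteq> 1" by simp
  ultimately show ?thesis using assms unfolding prime_nat_iff by blast
qed

text \<open>The multiples of 1 by \<open>0, ..., p - 1\<close> are distinct because the
  characteristic is \<open>p\<close>, so they exhaust the field; this is applied to
  \<open>x / b\<close>.\<close>

lemma prime_field_multiple:
  fixes x b :: "'g :: field"
  assumes "prime CARD('g)" "b \<noteq> 0"
  obtains k where "x = of_nat k * b"
proof -
  have fin: "finite (UNIV :: 'g set)"
    using prime_gt_0_nat[OF assms(1)] card_ge_0_finite by blast
  have "inj_on (of_nat :: nat \<Rightarrow> 'g) {..<CARD('g)}"
    by (intro inj_onI)
      (auto simp: of_nat_eq_iff_cong_CHAR cong_def CHAR_eq_prime_CARD[OF assms(1)])
  then have "(of_nat :: nat \<Rightarrow> 'g) ` {..<CARD('g)} = UNIV"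
    using fin by (intro card_subset_eq) (auto simp: card_image)
  then obtain k where "x / b = of_nat k" by (metis UNIV_I imageE)
  then show ?thesis using assms(2) that by (metis nonzero_divide_eq_eq)
qed

text \<open>Each further nonzero element enlarges the set of subset sums by at least one until the
  whole field is reached. This is a special case of the Cauchy-Davenport theorem, with summands
  \<open>{0, b i}\<close>.\<close>

lemma subset_sums_cover_prime_field:
  fixes b :: "'i \<Rightarrow> 'g :: field"
  assumes p: "prime CARD('g)" and "finite U" and nz: "\<And>i. i \<in> U \<Longrightarrow> b i \<noteq> 0"
    and "card U \<ge> CARD('g) - 1"
  obtains X where "X \<subseteq> U" "sum b X = x"
proof -
  have fin: "finite (UNIV :: 'g set)"
    using prime_gt_0_nat[OF p] card_ge_0_finite by blast
  have "card (sum b ` Pow U) \<ge> min CARD('g) (card U + 1)"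
    using \<open>finite U\<close> nz
  proof (induction U rule: finite_induct)
    case (insert u U)
    define T where "T = sum b ` Pow U"
    have IH: "card T \<ge> min CARD('g) (card U + 1)" using insert T_def by auto
    have sub: "T \<subseteq> sum b ` Pow (insert u U)" unfolding T_def by auto
    have shift: "s + b u \<in> sum b ` Pow (insert u U)" if s: "s \<in> T" for s
    proof -
      obtain X where X: "X \<subseteq> U" "s = sum b X" using s T_def by auto
      then have "finite X" "u \<notin> X" using insert.hyps finite_subset by auto
      then have "s + b u = sum b (insert u X)" using X by (simp add: add.commute)
      then show ?thesis using X(1) by (intro image_eqI[of _ _ "insert u X"]) auto
    qed
    show ?case
    proof (cases "\<forall>s \<in> T. s + b u \<in> T")
      \<comment> \<open>A set of sums that contains 0 and is closed under adding \<open>b u\<close>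
        contains all multiples of \<open>b u\<close>, hence the whole field.\<close>
      case True
      have "of_nat k * b u \<in> T" for k
      proof (induction k)
        case 0
        show ?case unfolding T_def by (rule image_eqI[of _ _ "{}"]) auto
      next
        case (Suc k)
        then show ?case using True by (auto simp: algebra_simps)
      qed
      then have "x \<in> T" for x
        using prime_field_multiple[OF p, of "b u" x] insert.prems by (metis insertI1)
      then have "sum b ` Pow (insert u U) = UNIV" using sub by auto
      then show ?thesis by simp
    next
      case False
      then obtain s where s: "s \<in> T" "s + b u \<notin> T" by auto
      have "card T + 1 = card (insert (s + b u) T)"
        using s(2) finite_subset[OF subset_UNIV fin] by simp
      also have "\<dots> \<le> card (sum b ` Pow (insert u U))"
        using sub shift[OF s(1)] finite_subset[OF subset_UNIV fin] by (intro card_mono) auto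
      finally show ?thesis using IH insert.hyps by simp
    qed
  qed (use p in \<open>simp add: prime_ge_1_nat\<close>)
  then have "card (sum b ` Pow U) \<ge> CARD('g)" using assms(4) by linarith
  then have "sum b ` Pow U = UNIV"
    using fin by (meson card_seteq subset_UNIV)
  then show ?thesis using that by (metis PowD UNIV_I imageE)
qed

text \<open>Enough indices remain outside of \<open>W\<close> to complete the sum over \<open>X\<close> to a zero sum.\<close>

lemma window_sums_eq_iff:
  fixes b :: "'i \<Rightarrow> 'g :: field" and b' :: "'i \<Rightarrow> 'k :: field"
  assumes p: "prime CARD('g)" and N: "finite N" "card N \<ge> 2 * CARD('g) - 1"
    and nz: "\<And>i. i \<in> N \<Longrightarrow> b i \<noteq> 0"
    and zero_sums: "\<And>S. S \<subseteq> N \<Longrightarrow> a + sum b S = 0 \<longleftrightarrow> a' + sum b' S = 0"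
    and W: "W \<subseteq> N" "card W \<le> CARD('g)" and X: "X \<subseteq> W" and Y: "Y \<subseteq> W"
  shows "sum b X = sum b Y \<longleftrightarrow> sum b' X = sum b' Y"
proof -
  have "finite W" using W(1) N(1) finite_subset by blast
  then have "card (N - W) \<ge> CARD('g) - 1"
    using W N by (simp add: card_Diff_subset)
  then obtain Z where Z: "Z \<subseteq> N - W" "sum b Z = - a - sum b X"
    using subset_sums_cover_prime_field[OF p, of "N - W" b "- a - sum b X"] N(1) nz by auto
  have fin: "finite X" "finite Y" "finite Z"
    using X Y Z(1) \<open>finite W\<close> N(1) by (auto intro: finite_subset)
  have disj: "X \<inter> Z = {}" "Y \<inter> Z = {}" using X Y Z(1) by auto
  have "a + sum b (X \<union> Z) = 0"
    using Z(2) by (simp add: sum.union_disjoint fin disj)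
  then have X_zero: "a' + (sum b' X + sum b' Z) = 0"
    using zero_sums[of "X \<union> Z"] W X Z(1) by (auto simp: sum.union_disjoint fin disj)
  \<comment> \<open>Exchanging \<open>X\<close> for \<open>Y\<close> in the zero sum over
    \<open>X \<union> Z\<close> keeps it zero exactly when \<open>X\<close> and \<open>Y\<close>
    have equal sums. The hypothesis \<open>zero_sums\<close> carries this test over to
    \<open>b'\<close>.\<close>
  have "sum b X = sum b Y \<longleftrightarrow> a + sum b (Y \<union> Z) = 0"
    using Z(2) by (auto simp: sum.union_disjoint fin disj)
  also have "\<dots> \<longleftrightarrow> a' + (sum b' Y + sum b' Z) = 0"
    using zero_sums[of "Y \<union> Z"] W Y Z(1) by (auto simp: sum.union_disjoint fin disj)
  also have "\<dots> \<longleftrightarrow> sum b' X = sum b' Y"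
    unfolding X_zero[symmetric] by auto
  finally show ?thesis .
qed

text \<open>Induction on \<open>k\<close>: compare \<open>X\<close> with \<open>insert e Y\<close>,
  where \<open>Y\<close> avoids \<open>e\<close> and has the previous multiple as its sum. The
  window has \<open>p\<close> elements so that \<open>p - 1\<close> remain without \<open>e\<close>,
  and another \<open>p - 1\<close> lie outside of it; hence the bound \<open>2p - 1\<close>. The
  number \<open>k\<close> is not reduced modulo \<open>p\<close>, because its image in the other
  field matters.\<close>

lemma zero_sums_imp_multiples:
  fixes b :: "'i \<Rightarrow> 'g :: field" and b' :: "'i \<Rightarrow> 'k :: field"
  assumes p: "prime CARD('g)" and N: "finite N" "card N \<ge> 2 * CARD('g) - 1"
    and nz: "\<And>i. i \<in> N \<Longrightarrow> b i \<noteq> 0"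
    and zero_sums: "\<And>S. S \<subseteq> N \<Longrightarrow> a + sum b S = 0 \<longleftrightarrow> a' + sum b' S = 0"
    and W: "W \<subseteq> N" "card W = CARD('g)" and e: "e \<in> W"
  shows "X \<subseteq> W \<Longrightarrow> sum b X = of_nat k * b e \<Longrightarrow> sum b' X = of_nat k * b' e"
proof (induction k arbitrary: X)
  case 0
  have "sum b X = sum b {} \<longleftrightarrow> sum b' X = sum b' {}"
    by (rule window_sums_eq_iff[OF p N nz zero_sums W(1)]) (use W 0 in auto)
  then show ?case using 0 by simp
next
  case (Suc k)
  have finW: "finite W" using W(1) N(1) finite_subset by blast
  have "card (W - {e}) \<ge> CARD('g) - 1" using W e finW by simp
  then obtain Y where Y: "Y \<subseteq> W - {e}" "sum b Y = of_nat k * b e"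
    using subset_sums_cover_prime_field[OF p, of "W - {e}" b "of_nat k * b e"] finW nz W(1)
    by auto
  have "finite Y" using Y(1) finW by (auto intro: finite_subset)
  moreover have "e \<notin> Y" using Y(1) by auto
  moreover have IH: "sum b' Y = of_nat k * b' e" using Suc.IH[of Y] Y by auto
  moreover have "sum b X = sum b (insert e Y) \<longleftrightarrow> sum b' X = sum b' (insert e Y)"
    by (rule window_sums_eq_iff[OF p N nz zero_sums W(1)]) (use W Suc.prems Y e in auto)
  ultimately show ?case using Y(2) Suc.prems(2) by (simp add: algebra_simps)
qed

text \<open>In the prime field the empty sum equals \<open>p\<close> times \<open>b e\<close>.
  Carried over, this says that \<open>p\<close> times \<open>b' e\<close> is zero, and
  \<open>b' e\<close> can be cancelled.\<close>

lemma zero_sums_imp_CHAR: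
  fixes b :: "'i \<Rightarrow> 'g :: field" and b' :: "'i \<Rightarrow> 'k :: field"
  assumes p: "prime CARD('g)" and N: "finite N" "card N \<ge> 2 * CARD('g) - 1"
    and nz: "\<And>i. i \<in> N \<Longrightarrow> b i \<noteq> 0" and nz': "\<And>i. i \<in> N \<Longrightarrow> b' i \<noteq> 0"
    and zero_sums: "\<And>S. S \<subseteq> N \<Longrightarrow> a + sum b S = 0 \<longleftrightarrow> a' + sum b' S = 0"
  shows "CHAR('k) = CARD('g)"
proof -
  have "CARD('g) \<ge> 2" using p by (rule prime_ge_2_nat)
  then have p_le: "CARD('g) \<le> 2 * CARD('g) - 1" by linarith
  obtain W where W: "W \<subseteq> N" "card W = CARD('g)"
    using N obtain_subset_with_card_n[of "CARD('g)" N]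
    by (metis le_trans p_le)
  then obtain e where e: "e \<in> W"
    using \<open>CARD('g) \<ge> 2\<close> by (metis all_not_in_conv card.empty not_numeral_le_zero)
  have "(of_nat CARD('g) :: 'g) = 0"
    by (simp add: of_nat_eq_0_iff_char_dvd CHAR_eq_prime_CARD[OF p])
  then have "sum b' {} = of_nat CARD('g) * b' e"
    by (intro zero_sums_imp_multiples[OF p N nz zero_sums W e]) auto
  then have "(of_nat CARD('g) :: 'k) = 0" using nz' W(1) e by auto
  then have "CHAR('k) dvd CARD('g)" by (simp add: of_nat_eq_0_iff_char_dvd)
  moreover have "CHAR('k) \<noteq> 1" by simp
  ultimately show ?thesis using p unfolding prime_nat_iff by blast
qed

text \<open>The ratio is read off at one index \<open>e\<close>; any other index shares a window
  with \<open>e\<close> because \<open>p \<ge> 2\<close>. A single subset with sum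
  \<open>- a\<close> then determines \<open>a'\<close>.\<close>

lemma zero_sums_imp_proportional:
  fixes b b' :: "'i \<Rightarrow> 'g :: field"
  assumes p: "prime CARD('g)" and N: "finite N" "card N \<ge> 2 * CARD('g) - 1"
    and nz: "\<And>i. i \<in> N \<Longrightarrow> b i \<noteq> 0" and nz': "\<And>i. i \<in> N \<Longrightarrow> b' i \<noteq> 0"
    and zero_sums: "\<And>S. S \<subseteq> N \<Longrightarrow> a + sum b S = 0 \<longleftrightarrow> a' + sum b' S = 0"
  obtains c where "c \<noteq> 0" "a' = c * a" "\<And>i. i \<in> N \<Longrightarrow> b' i = c * b i"
proof -
  have p2: "CARD('g) \<ge> 2" using p by (rule prime_ge_2_nat)
  then have "N \<noteq> {}" using N by auto
  then obtain e where e: "e \<in> N" by auto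
  define c where "c = b' e / b e"
  have c: "b' i = c * b i" if i: "i \<in> N" for i
  proof -
    have "card {e, i} \<le> CARD('g)" using p2 by (cases "e = i") auto
    moreover have "CARD('g) \<le> card N" using p2 N(2) by linarith
    ultimately obtain W where W: "{e, i} \<subseteq> W" "W \<subseteq> N" "card W = CARD('g)"
      using exists_subset_between[of "{e, i}" "CARD('g)" N] N(1) e i by blast
    obtain k where k: "b i = of_nat k * b e"
      using prime_field_multiple[OF p nz[OF e]] by blast
    have "sum b' {i} = of_nat k * b' e"
      by (rule zero_sums_imp_multiples[OF p N nz zero_sums W(2,3)]) (use W k in auto)
    then show ?thesis using k nz[OF e] by (simp add: c_def)
  qed
  have "CARD('g) - 1 \<le> card N" using N(2) by linarith
  then obtain S where S: "S \<subseteq> N" "sum b S = - a"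
    using subset_sums_cover_prime_field[OF p, of N b "- a"] N nz by auto
  have "sum b' S = c * sum b S"
    using S(1) c by (auto simp: sum_distrib_left intro!: sum.cong)
  then have "a' = c * a" using S zero_sums[OF S(1)] by (simp add: add_eq_0_iff)
  moreover have "c \<noteq> 0" using nz[OF e] nz'[OF e] by (simp add: c_def)
  ultimately show ?thesis using c that by blast
qed

subsection \<open>Linear independence of families\<close>

text \<open>Families instead of sets of vectors: equal vectors with different labels count as
  dependent. Vectors are functions on all natural numbers, so no row count has to be carried
  along.\<close>

definition lin_indep :: "('e \<Rightarrow> nat \<Rightarrow> 'f :: field) \<Rightarrow> 'e set \<Rightarrow> bool" where
  "lin_indep v X \<longleftrightarrow>
     (\<forall>c. (\<forall>i. (\<Sum>e\<in>X. c e * v e i) = 0) \<longrightarrow> (\<forall>e\<in>X. c e = 0))"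

lemma lin_indep_reindex:
  assumes "inj_on g J"
  shows "lin_indep v (g ` J) \<longleftrightarrow> lin_indep (v \<circ> g) J"
proof
  assume ind: "lin_indep v (g ` J)"
  show "lin_indep (v \<circ> g) J"
    unfolding lin_indep_def
  proof (intro allI impI)
    fix c assume c: "\<forall>i. (\<Sum>e\<in>J. c e * (v \<circ> g) e i) = 0"
    have "(\<Sum>e\<in>g ` J. c (inv_into J g e) * v e i) = 0" for i
      using c by (simp add: sum.reindex[OF assms] inv_into_f_f[OF assms])
    then have "\<forall>e\<in>g ` J. c (inv_into J g e) = 0" using ind unfolding lin_indep_def by meson
    then show "\<forall>e\<in>J. c e = 0" by (simp add: inv_into_f_f[OF assms])
  qed
next
  assume ind: "lin_indep (v \<circ> g) J"
  show "lin_indep v (g ` J)"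
    unfolding lin_indep_def
  proof (intro allI impI)
    fix c assume c: "\<forall>i. (\<Sum>e\<in>g ` J. c e * v e i) = 0"
    then have "\<forall>i. (\<Sum>e\<in>J. (c \<circ> g) e * (v \<circ> g) e i) = 0"
      by (simp add: sum.reindex[OF assms])
    then have "\<forall>e\<in>J. (c \<circ> g) e = 0" using ind unfolding lin_indep_def by blast
    then show "\<forall>e\<in>g ` J. c e = 0" by simp
  qed
qed

lemma lin_indep_image_iff:
  assumes "inj_on g J"
  shows "lin_indep v (g ` J) \<longleftrightarrow>
    (\<forall>c. (\<forall>i. (\<Sum>j\<in>J. c j * v (g j) i) = 0) \<longrightarrow> (\<forall>j\<in>J. c j = 0))"
  unfolding lin_indep_reindex[OF assms] by (simp add: lin_indep_def)

lemma lin_indep_pairD: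
  assumes "lin_indep v {a, b}" "a \<noteq> b" "\<forall>i. p * v a i + q * v b i = 0"
  shows "p = 0 \<and> q = 0"
proof -
  define c where "c e = (if e = a then p else q)" for e
  have "\<forall>i. (\<Sum>e\<in>{a, b}. c e * v e i) = 0" using assms(2,3) by (simp add: c_def)
  then have "c a = 0" "c b = 0" using assms(1) unfolding lin_indep_def by blast+
  then show ?thesis using assms(2) by (simp add: c_def)
qed

lemma not_lin_indep_tripleE:
  assumes "\<not> lin_indep v {a, b, d}" "a \<noteq> b" "a \<noteq> d" "b \<noteq> d"
  obtains p q r where "p \<noteq> 0 \<or> q \<noteq> 0 \<or> r \<noteq> 0"
    "\<And>i. p * v a i + q * v b i + r * v d i = 0"
proof -
  obtain c where "\<forall>i. (\<Sum>e\<in>{a, b, d}. c e * v e i) = 0" "\<exists>e\<in>{a, b, d}. c e \<noteq> 0"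
    using assms(1) unfolding lin_indep_def by blast
  then show ?thesis using that[of "c a" "c b" "c d"] assms(2-) by (auto simp: add.assoc)
qed

lemma lin_indep_scale:
  assumes "lin_indep v X" "\<And>e. e \<in> X \<Longrightarrow> f e \<noteq> 0"
  shows "lin_indep (\<lambda>e i. f e * v e i) X"
  unfolding lin_indep_def
proof (intro allI impI)
  fix c assume "\<forall>i. (\<Sum>e\<in>X. c e * (f e * v e i)) = 0"
  then have "\<forall>i. (\<Sum>e\<in>X. (c e * f e) * v e i) = 0" by (simp add: mult.assoc)
  then have "\<forall>e\<in>X. c e * f e = 0"
    using spec[OF assms(1)[unfolded lin_indep_def], of "\<lambda>e. c e * f e"] by blast
  then show "\<forall>e\<in>X. c e = 0" using assms(2) by simp
qed

lemma lin_indep_cong: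
  assumes "\<And>e i. e \<in> X \<Longrightarrow> v e i = w e i"
  shows "lin_indep v X \<longleftrightarrow> lin_indep w X"
  unfolding lin_indep_def using assms by (simp cong: sum.cong)

subsection \<open>Column matroids\<close>

text \<open>The value 0 past the last row makes appended zero rows invisible.\<close>

definition column :: "'f :: field mat \<Rightarrow> nat \<Rightarrow> nat \<Rightarrow> 'f" where
  "column A j i = (if i < dim_row A then A $$ (i, j) else 0)"

text \<open>Translates set-based dependence into families. Injectivity of \<open>col A\<close> lets
  coefficients move between columns and column indices.\<close>

lemma indep_columns_iff:
  fixes A :: "'f :: field mat"
  assumes J: "J \<subseteq> {..<dim_col A}"
  shows "indep_columns A J \<longleftrightarrow> lin_indep (column A) J"
proof -
  interpret vec_space "TYPE('f)" "dim_row A" .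
  have fin: "finite J" using J finite_subset by blast
  have carr: "col A ` S \<subseteq> carrier_vec (dim_row A)" for S by auto
  have lincomb_col: "lincomb a (col A ` S) $ i = (\<Sum>j\<in>S. a (col A j) * column A j i)"
    if "i < dim_row A" "S \<subseteq> J" "inj_on (col A) S" for a S i
    using that J by (subst lincomb_index[OF that(1) carr])
      (auto simp: sum.reindex column_def intro!: sum.cong)
  show ?thesis
  proof
    assume "indep_columns A J"
    then have inj: "inj_on (col A) J" and ind: "\<not> lin_dep (col A ` J)"
      by (auto simp: indep_columns_def)
    show "lin_indep (column A) J"
      unfolding lin_indep_def
    proof (intro allI impI ballI)
      fix c j assume c: "\<forall>i. (\<Sum>j\<in>J. c j * column A j i) = 0" and j: "j \<in> J"
      define a where "a w = c (inv_into J (col A) w)" for w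
      have a: "a (col A j) = c j" if "j \<in> J" for j
        using that inj by (simp add: a_def inv_into_f_f)
      have "lincomb a (col A ` J) = 0\<^sub>v (dim_row A)"
      proof (rule eq_vecI)
        fix i assume "i < dim_vec (0\<^sub>v (dim_row A) :: 'f vec)"
        then have i: "i < dim_row A" by simp
        have "lincomb a (col A ` J) $ i = (\<Sum>j\<in>J. c j * column A j i)"
          by (subst lincomb_col[OF i _ inj]) (auto simp: a)
        then show "lincomb a (col A ` J) $ i = 0\<^sub>v (dim_row A) $ i" using c i by simp
      qed (use fin carr in \<open>simp add: lincomb_dim\<close>)
      then have "a (col A j) = 0"
        using ind j fin unfolding lin_dep_def by (auto simp: class_field_def)
      then show "c j = 0" using a[OF j] by simp
    qed
  next
    assume ind: "lin_indep (column A) J"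
    have inj: "inj_on (col A) J"
    proof (rule inj_onI, rule ccontr)
      fix j k assume jk: "j \<in> J" "k \<in> J" "col A j = col A k" "j \<noteq> k"
      \<comment> \<open>Two equal columns would satisfy the relation with coefficients 1 and
        -1.\<close>
      define c where "c l = (if l = j then 1 else if l = k then - 1 else 0 :: 'f)" for l
      have "j < dim_col A" "k < dim_col A" using jk(1,2) J by auto
      then have eq: "column A j i = column A k i" for i
        using arg_cong[OF jk(3), of "\<lambda>w. vec_index w i"]
        by (cases "i < dim_row A") (simp_all add: column_def)
      have "(\<Sum>l\<in>J. c l * column A l i) = 0" for i
      proof -
        have "(\<Sum>l\<in>J. c l * column A l i) = (\<Sum>l\<in>{j, k}. c l * column A l i)"
          using jk fin by (intro sum.mono_neutral_right) (auto simp: c_def)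
        then show ?thesis using jk(4) eq by (simp add: c_def)
      qed
      then have "c j = 0" using ind jk(1) unfolding lin_indep_def by blast
      then show False by (simp add: c_def)
    qed
    moreover have "\<not> lin_dep (col A ` J)"
    proof
      assume "lin_dep (col A ` J)"
      then obtain S a w where S: "finite S" "S \<subseteq> col A ` J" "w \<in> S"
        and a: "lincomb a S = 0\<^sub>v (dim_row A)" "a w \<noteq> 0"
        unfolding lin_dep_def by auto
      then obtain K where K: "K \<subseteq> J" "S = col A ` K" by (meson subset_imageE)
      have injK: "inj_on (col A) K" using inj K(1) inj_on_subset by blast
      define c where "c j = (if j \<in> K then a (col A j) else 0)" for j
      have "(\<Sum>j\<in>J. c j * column A j i) = 0" for i
      proof -
        have "(\<Sum>j\<in>J. c j * column A j i) = (\<Sum>j\<in>K. a (col A j) * column A j i)"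
          using K(1) fin by (intro sum.mono_neutral_cong_right) (auto simp: c_def)
        also have "\<dots> = 0"
        proof (cases "i < dim_row A")
          case True
          then show ?thesis using lincomb_col[OF True K(1) injK, of a] a(1) K(2) by simp
        qed (simp add: column_def)
        finally show ?thesis .
      qed
      then have "\<forall>j\<in>J. c j = 0" using ind unfolding lin_indep_def by blast
      then have "\<forall>j\<in>K. a (col A j) = 0" unfolding c_def using K(1) by (metis subsetD)
      then show False using S(3) K(2) a(2) by auto
    qed
    ultimately show "indep_columns A J" by (simp add: indep_columns_def)
  qed
qed

text \<open>Indexing by elements makes matrices with different column orders comparable.\<close>

definition element_column :: "'f :: field mat \<Rightarrow> 'e list \<Rightarrow> 'e \<Rightarrow> nat \<Rightarrow> 'f" where
  "element_column A es e = column A (inv_into {..<length es} ((!) es) e)"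

lemma element_column_nth:
  assumes "distinct es" "j < length es"
  shows "element_column A es (es ! j) = column A j"
  using assms by (simp add: element_column_def inv_into_f_f inj_on_nth)

text \<open>Distinct labels let sets of elements and sets of column indices correspond. The
  conclusion is the hypothesis \<open>rep\<close> of the lemmas on spikes below.\<close>

lemma represents_indep_iff:
  assumes "represents A es E indep"
  shows "indep X \<longleftrightarrow> X \<subseteq> E \<and> lin_indep (element_column A es) X"
proof -
  have es: "distinct es" "set es = E" "dim_col A = length es" "indep = column_matroid A es"
    using assms by (auto simp: represents_def)
  have inj: "inj_on ((!) es) {..<length es}" using es(1) by (simp add: inj_on_nth)
  have image: "E = (!) es ` {..<length es}"
    using es(2) by (auto simp: set_conv_nth)
  have iff: "indep_columns A J \<longleftrightarrow> lin_indep (element_column A es) ((!) es ` J)"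
    if "J \<subseteq> {..<length es}" for J
  proof -
    have "lin_indep (element_column A es) ((!) es ` J) \<longleftrightarrow> lin_indep (element_column A es \<circ> (!) es) J"
      using that inj by (intro lin_indep_reindex) (rule inj_on_subset)
    also have "\<dots> \<longleftrightarrow> lin_indep (column A) J"
    proof -
      have "(\<Sum>j\<in>J. c j * (element_column A es \<circ> (!) es) j i) = (\<Sum>j\<in>J. c j * column A j i)"
        for c i using that es(1) by (intro sum.cong) (auto simp: element_column_nth)
      then show ?thesis unfolding lin_indep_def by simp
    qed
    finally show ?thesis using indep_columns_iff[of J A] that es(3) by simp
  qed
  show ?thesis
  proof
    assume "indep X"
    then show "X \<subseteq> E \<and> lin_indep (element_column A es) X"
      using iff image es(3) unfolding es(4) column_matroid_def by auto
  next
    assume X: "X \<subseteq> E \<and> lin_indep (element_column A es) X"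
    then obtain J where J: "J \<subseteq> {..<length es}" "X = (!) es ` J"
      unfolding image by (meson subset_imageE)
    then show "indep X"
      using iff[OF J(1)] X es(3) unfolding es(4) column_matroid_def by auto
  qed
qed

lemma represents_append_zero_rows:
  assumes "represents A es E indep"
  shows "represents (A @\<^sub>r 0\<^sub>m m (dim_col A)) es E indep"
proof -
  let ?A = "A @\<^sub>r 0\<^sub>m m (dim_col A)"
  have dim: "dim_col ?A = dim_col A" by (simp add: append_rows_def)
  have "column ?A j i = column A j i" if "j < dim_col A" for i j
    using that by (simp add: column_def append_rows_def)
  then have "lin_indep (column ?A) J \<longleftrightarrow> lin_indep (column A) J" if "J \<subseteq> {..<dim_col A}" for J
    using that by (intro lin_indep_cong) auto
  then have "indep_columns ?A J \<longleftrightarrow> indep_columns A J" if "J \<subseteq> {..<dim_col A}" for J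
    using that indep_columns_iff[of J ?A] indep_columns_iff[of J A] dim by simp
  then have "column_matroid ?A es = column_matroid A es"
    unfolding column_matroid_def dim by (intro ext) (metis (no_types, opaque_lifting))
  then show ?thesis using assms dim by (simp add: represents_def)
qed

subsection \<open>Row reduction\<close>

text \<open>Isolates those operations of \<open>equivalent_mat\<close> that keep every linear
  relation among the columns.\<close>

inductive row_equiv :: "'f :: field mat \<Rightarrow> 'f mat \<Rightarrow> bool" for A where
  refl: "row_equiv A A"
| swap_rows: "row_equiv A B \<Longrightarrow> k < dim_row B \<Longrightarrow> l < dim_row B \<Longrightarrow>
    row_equiv A (swaprows k l B)"
| scale_row: "row_equiv A B \<Longrightarrow> k < dim_row B \<Longrightarrow> a \<noteq> 0 \<Longrightarrow> row_equiv A (multrow k a B)"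
| add_row: "row_equiv A B \<Longrightarrow> k < dim_row B \<Longrightarrow> l < dim_row B \<Longrightarrow> k \<noteq> l \<Longrightarrow>
    row_equiv A (addrow a k l B)"

lemma row_equiv_dim: "row_equiv A B \<Longrightarrow> dim_row B = dim_row A \<and> dim_col B = dim_col A"
  by (induction rule: row_equiv.induct) auto

lemma row_equiv_trans: "row_equiv B C \<Longrightarrow> row_equiv A B \<Longrightarrow> row_equiv A C"
  by (induction rule: row_equiv.induct) (auto intro: row_equiv.intros)

lemma row_equiv_sym: "row_equiv A B \<Longrightarrow> row_equiv B A"
proof (induction rule: row_equiv.induct)
  case (swap_rows B k l)
  have "swaprows k l (swaprows k l B) = B"
    using swap_rows by (intro eq_matI) auto
  moreover have "row_equiv (swaprows k l B) (swaprows k l (swaprows k l B))"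
    using swap_rows by (intro row_equiv.intros) auto
  ultimately show ?case using swap_rows.IH row_equiv_trans by metis
next
  case (scale_row B k a)
  have "multrow k (inverse a) (multrow k a B) = B"
    using scale_row by (intro eq_matI) auto
  moreover have "row_equiv (multrow k a B) (multrow k (inverse a) (multrow k a B))"
    using scale_row by (intro row_equiv.intros) auto
  ultimately show ?case using scale_row.IH row_equiv_trans by metis
next
  case (add_row B k l a)
  have "addrow (- a) k l (addrow a k l B) = B"
    using add_row by (intro eq_matI) auto
  moreover have "row_equiv (addrow a k l B) (addrow (- a) k l (addrow a k l B))"
    using add_row by (intro row_equiv.intros) auto
  ultimately show ?case using add_row.IH row_equiv_trans by metis
qed (rule row_equiv.refl)

lemma row_equiv_imp_equivalent_mat:
  "row_equiv A B \<Longrightarrow> equivalent_mat C A \<Longrightarrow> equivalent_mat C B"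
  by (induction rule: row_equiv.induct) (auto intro: equivalent_mat.intros)

text \<open>Every row of \<open>B\<close> is a linear combination of rows of \<open>A\<close>. With
  \<open>row_equiv_sym\<close> it follows that both matrices have the same relations among their
  columns.\<close>

lemma row_equiv_relation:
  assumes "row_equiv A B" "J \<subseteq> {..<dim_col A}" "\<forall>i. (\<Sum>j\<in>J. c j * column A j i) = 0"
  shows "(\<Sum>j\<in>J. c j * column B j i) = 0"
  using assms
proof (induction arbitrary: i rule: row_equiv.induct)
  case (swap_rows B k l)
  note d = row_equiv_dim[OF swap_rows.hyps(1)]
  have "(\<Sum>j\<in>J. c j * column (swaprows k l B) j i) =
      (\<Sum>j\<in>J. c j * column B j (if i = k then l else if i = l then k else i))"
    using swap_rows d by (intro sum.cong) (auto simp: column_def)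
  then show ?case using swap_rows by simp
next
  case (scale_row B k a)
  note d = row_equiv_dim[OF scale_row.hyps(1)]
  have "(\<Sum>j\<in>J. c j * column (multrow k a B) j i) =
      (\<Sum>j\<in>J. (if i = k then a else 1) * (c j * column B j i))"
    using scale_row.prems d by (intro sum.cong) (auto simp: column_def)
  then show ?case using scale_row by (simp flip: sum_distrib_left)
next
  case (add_row B k l a)
  note d = row_equiv_dim[OF add_row.hyps(1)]
  have "(\<Sum>j\<in>J. c j * column (addrow a k l B) j i) =
      (\<Sum>j\<in>J. (if i = k then a else 0) * (c j * column B j l) + c j * column B j i)"
    using add_row.prems add_row.hyps d by (intro sum.cong) (auto simp: column_def algebra_simps)
  then show ?case using add_row by (simp add: sum.distrib flip: sum_distrib_left)
qed simp

lemma row_equiv_clear_column: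
  fixes A :: "'f :: field mat"
  assumes l: "l < dim_row A"
  shows "row_equiv A (mat (dim_row A) (dim_col A)
    (\<lambda>(i, c). if i \<noteq> l then A $$ (i, c) - f i * A $$ (l, c) else A $$ (i, c)))"
proof -
  \<comment> \<open>The state after treating the rows with index less than \<open>k\<close>; row
    \<open>l\<close> never changes, so it is still available at every step.\<close>
  define M where "M k = mat (dim_row A) (dim_col A)
    (\<lambda>(i, c). if i < k \<and> i \<noteq> l then A $$ (i, c) - f i * A $$ (l, c) else A $$ (i, c))" for k
  have "row_equiv A (M k)" if "k \<le> dim_row A" for k
    using that
  proof (induction k)
    case 0
    have "M 0 = A" by (intro eq_matI) (auto simp: M_def)
    then show ?case by (simp add: row_equiv.refl)
  next
    case (Suc k)
    show ?case
    proof (cases "k = l")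
      case True
      then have "M (Suc k) = M k" by (intro eq_matI) (auto simp: M_def)
      then show ?thesis using Suc by simp
    next
      case False
      have "M (Suc k) = addrow (- f k) k l (M k)"
        using False l Suc.prems by (intro eq_matI) (auto simp: M_def)
      then show ?thesis using Suc False l by (auto simp: M_def intro!: row_equiv.add_row)
    qed
  qed
  from this[of "dim_row A"] have "row_equiv A (M (dim_row A))" by simp
  moreover have "M (dim_row A) = mat (dim_row A) (dim_col A)
    (\<lambda>(i, c). if i \<noteq> l then A $$ (i, c) - f i * A $$ (l, c) else A $$ (i, c))"
    by (intro eq_matI) (auto simp: M_def)
  ultimately show ?thesis by simp
qed

text \<open>Gauss-Jordan elimination with prescribed pivot columns; independence supplies a pivot at
  every stage.\<close>

lemma row_reduce:
  fixes A :: "'f :: field mat" and j :: "nat \<Rightarrow> nat"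
  assumes J: "j ` {..<r} \<subseteq> {..<dim_col A}" "inj_on j {..<r}"
    and ind: "lin_indep (column A) (j ` {..<r})"
  obtains R where "row_equiv A R"
    "\<And>q i. q < r \<Longrightarrow> column R (j q) i = (if i = q then 1 else 0)"
proof -
  have "\<exists>R. row_equiv A R \<and> (\<forall>q<k. \<forall>i. column R (j q) i = (if i = q then 1 else 0))"
    if "k \<le> r" for k
    using that
  proof (induction k)
    case 0
    show ?case using row_equiv.refl by auto
  next
    case (Suc k)
    then obtain R where R: "row_equiv A R"
      and cols: "\<And>q i. q < k \<Longrightarrow> column R (j q) i = (if i = q then 1 else 0)" by auto
    have dimR: "dim_row R = dim_row A" "dim_col R = dim_col A" using row_equiv_dim[OF R] by auto
    have jk: "j q < dim_col A" if "q \<le> k" for q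
      using that J(1) Suc.prems by (auto simp: image_subset_iff)
    \<comment> \<open>Without a pivot in row \<open>k\<close> or later, column \<open>j k\<close> of
      \<open>R\<close> would be a combination of the earlier unit columns. This relation holds for
      \<open>A\<close> too and contradicts independence.\<close>
    have "\<exists>l\<ge>k. column R (j k) l \<noteq> 0"
    proof (rule ccontr)
      assume "\<not> ?thesis"
      then have low: "column R (j k) l = 0" if "l \<ge> k" for l using that by auto
      define c where "c q = (if q = k then - 1 else if q < k then column R (j k) q else 0)" for q
      define d where "d = c \<circ> inv_into {..<r} j"
      have d: "d (j q) = c q" if "q < r" for q
        using that J(2) by (simp add: d_def inv_into_f_f)
      have "(\<Sum>e\<in>j ` {..<r}. d e * column R e i) = 0" for i
      proof -
        have "(\<Sum>e\<in>j ` {..<r}. d e * column R e i) = (\<Sum>q<r. c q * column R (j q) i)"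
          by (simp add: sum.reindex[OF J(2)] d)
        also have "\<dots> = (\<Sum>q<Suc k. c q * column R (j q) i)"
          using Suc.prems by (intro sum.mono_neutral_right) (auto simp: c_def)
        also have "\<dots> = (\<Sum>q<k. if i = q then column R (j k) q else 0) - column R (j k) i"
          by (simp add: c_def cols if_distrib cong: if_cong)
        also have "\<dots> = 0" using low by (cases "i < k") auto
        finally show ?thesis .
      qed
      then have "(\<Sum>e\<in>j ` {..<r}. d e * column A e i) = 0" for i
        by (intro row_equiv_relation[OF row_equiv_sym[OF R]]) (use J(1) dimR in auto)
      then have "\<forall>e\<in>j ` {..<r}. d e = 0" using ind unfolding lin_indep_def by blast
      then have "d (j k) = 0" using Suc.prems by simp
      then show False using d[of k] Suc.prems by (simp add: c_def)
    qed
    then obtain l where l: "l \<ge> k" "column R (j k) l \<noteq> 0" by auto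
    then have lr: "l < dim_row R" by (auto simp: column_def split: if_splits)
    have kr: "k < dim_row R" using l(1) lr by simp
    define R1 where "R1 = swaprows k l R"
    define R2 where "R2 = multrow k (inverse (R1 $$ (k, j k))) R1"
    define R3 where "R3 = mat (dim_row R2) (dim_col R2)
      (\<lambda>(i, c). if i \<noteq> k then R2 $$ (i, c) - R2 $$ (i, j k) * R2 $$ (k, c) else R2 $$ (i, c))"
    have R1: "dim_row R1 = dim_row A" "dim_col R1 = dim_col A" "R1 $$ (k, j k) \<noteq> 0"
      using l lr kr jk[of k] by (auto simp: R1_def dimR column_def)
    have R2: "dim_row R2 = dim_row A" "dim_col R2 = dim_col A" "R2 $$ (k, j k) = 1"
      using R1 kr jk[of k] by (auto simp: R2_def dimR)
    have R3: "dim_row R3 = dim_row A" "dim_col R3 = dim_col A" by (auto simp: R3_def R2)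
    have "row_equiv A R1" unfolding R1_def by (intro row_equiv.intros R kr lr)
    then have "row_equiv A R2"
      unfolding R2_def using R1 kr dimR by (intro row_equiv.intros) auto
    moreover have "row_equiv R2 R3"
      unfolding R3_def using kr dimR R2 by (intro row_equiv_clear_column) simp
    ultimately have "row_equiv A R3" using row_equiv_trans by blast
    moreover have "column R3 (j q) i = (if i = q then 1 else 0)" if q: "q < Suc k" for q i
    proof (cases "q = k")
      case True
      then show ?thesis using jk[of k] R2 kr dimR by (auto simp: column_def R3_def)
    next
      case False
      \<comment> \<open>The earlier unit column \<open>j q\<close> vanishes in rows \<open>k\<close>
        and \<open>l\<close>, since both indices exceed \<open>q\<close>; so swapping, scaling and
        clearing all leave it unchanged.\<close>
      then have qk: "q < k" using q by simp
      have entry: "R $$ (i, j q) = (if i = q then 1 else 0)" if "i < dim_row A" for i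
        using cols[OF qk, of i] that dimR by (simp add: column_def)
      have e1: "R1 $$ (i, j q) = (if i = q then 1 else 0)" if "i < dim_row A" for i
        using that entry qk l(1) lr kr jk[of q] dimR by (auto simp: R1_def)
      have e2: "R2 $$ (i, j q) = (if i = q then 1 else 0)" if "i < dim_row A" for i
        using that e1 qk kr jk[of q] dimR R1 by (auto simp: R2_def)
      show ?thesis using e2 qk kr jk[of q] dimR R2 by (auto simp: column_def R3_def)
    qed
    ultimately show ?case by blast
  qed
  from this[of r] show ?thesis using that by auto
qed

text \<open>The reduced form with respect to an independent set of columns is determined by the
  coordinates of the other columns, so it is the same for \<open>A\<close> and \<open>B\<close>.\<close>

lemma same_coordinates_imp_row_equiv:
  fixes A B :: "'f :: field mat" and j :: "nat \<Rightarrow> nat"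
  assumes dim: "dim_row A = dim_row B" "dim_col A = dim_col B"
    and J: "j ` {..<r} \<subseteq> {..<dim_col A}" "inj_on j {..<r}"
    and ind: "lin_indep (column A) (j ` {..<r})" "lin_indep (column B) (j ` {..<r})"
    and coord: "\<And>k. k < dim_col A \<Longrightarrow> \<exists>c. \<forall>i.
      column A k i = (\<Sum>q<r. c q * column A (j q) i) \<and>
      column B k i = (\<Sum>q<r. c q * column B (j q) i)"
  shows "row_equiv A B"
proof -
  have reduced: "column R k i = (\<Sum>q<r. c q * (if i = q then 1 else 0))"
    if R: "row_equiv C R" "\<And>q i. q < r \<Longrightarrow> column R (j q) i = (if i = q then 1 else 0)"
      and k: "k < dim_col C" "j ` {..<r} \<subseteq> {..<dim_col C}"
      and c: "\<forall>i. column C k i = (\<Sum>q<r. c q * column C (j q) i)"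
    for C R :: "'f mat" and k c i
  proof -
    \<comment> \<open>One coefficient vector over all columns for the relation between column
      \<open>k\<close> and the basis columns, which row operations preserve. Column \<open>k\<close>
      may itself be a basis column; subtracting its indicator covers both cases.\<close>
    define d where
      "d l = (if l \<in> j ` {..<r} then c (inv_into {..<r} j l) else 0) - (if l = k then 1 else 0)" for l
    have sum_d: "(\<Sum>l<dim_col C. d l * column D l i) =
        (\<Sum>q<r. c q * column D (j q) i) - column D k i" for D i
    proof -
      have "(\<Sum>l<dim_col C. d l * column D l i) =
          (\<Sum>l<dim_col C. (if l \<in> j ` {..<r} then c (inv_into {..<r} j l) * column D l i else 0)) -
          (\<Sum>l<dim_col C. if l = k then column D l i else 0)"
        unfolding sum_subtractf[symmetric] by (intro sum.cong) (auto simp: d_def algebra_simps)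
      also have "(\<Sum>l<dim_col C.
            (if l \<in> j ` {..<r} then c (inv_into {..<r} j l) * column D l i else 0)) =
          (\<Sum>l\<in>j ` {..<r}. c (inv_into {..<r} j l) * column D l i)"
        using k(2) by (intro sum.mono_neutral_cong_right) auto
      also have "\<dots> = (\<Sum>q<r. c q * column D (j q) i)"
        by (simp add: sum.reindex[OF J(2)] inv_into_f_f[OF J(2)])
      finally show ?thesis using k(1) by simp
    qed
    have "(\<Sum>l<dim_col C. d l * column R l i) = 0"
      by (rule row_equiv_relation[OF R(1)]) (use c in \<open>auto simp: sum_d\<close>)
    then show ?thesis using sum_d[of R i] R(2) by simp
  qed
  obtain R where R: "row_equiv A R"
    "\<And>q i. q < r \<Longrightarrow> column R (j q) i = (if i = q then 1 else 0)"
    using row_reduce[OF J ind(1)] by blast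
  obtain S where S: "row_equiv B S"
    "\<And>q i. q < r \<Longrightarrow> column S (j q) i = (if i = q then 1 else 0)"
    using row_reduce[OF J(1)[unfolded dim] J(2) ind(2)] by blast
  have "R = S"
  proof (rule eq_matI)
    fix i k assume ik: "i < dim_row S" "k < dim_col S"
    then have k: "k < dim_col A" using row_equiv_dim[OF S(1)] dim by simp
    obtain c where c: "\<forall>i. column A k i = (\<Sum>q<r. c q * column A (j q) i)"
      "\<forall>i. column B k i = (\<Sum>q<r. c q * column B (j q) i)"
      using coord[OF k] by blast
    have "column R k i = column S k i"
      using reduced[OF R k J(1) c(1), of i]
        reduced[OF S k[unfolded dim] J(1)[unfolded dim] c(2), of i] by simp
    then show "R $$ (i, k) = S $$ (i, k)"
      using ik row_equiv_dim[OF S(1)] row_equiv_dim[OF R(1)] dim by (simp add: column_def)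
  qed (use row_equiv_dim[OF S(1)] row_equiv_dim[OF R(1)] dim in auto)
  then show ?thesis using R(1) row_equiv_sym[OF S(1)] row_equiv_trans by blast
qed

lemma equivalent_mat_scale_cols:
  fixes A :: "'f :: field mat"
  assumes "\<And>j. j < dim_col A \<Longrightarrow> f j \<noteq> 0"
  shows "equivalent_mat A (mat (dim_row A) (dim_col A) (\<lambda>(i, j). f j * A $$ (i, j)))"
proof -
  define M where "M k = mat (dim_row A) (dim_col A)
    (\<lambda>(i, j). (if j < k then f j else 1) * A $$ (i, j))" for k
  have "equivalent_mat A (M k)" if "k \<le> dim_col A" for k
    using that
  proof (induction k)
    case 0
    have "M 0 = A" by (intro eq_matI) (auto simp: M_def)
    then show ?case by (simp add: equivalent_mat.refl)
  next
    case (Suc k)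
    have "M (Suc k) = multcol k (f k) (M k)"
      using Suc.prems by (intro eq_matI) (auto simp: M_def less_Suc_eq)
    then show ?case using Suc assms by (auto simp: M_def intro!: equivalent_mat.scale_col)
  qed
  from this[of "dim_col A"] have "equivalent_mat A (M (dim_col A))" by simp
  moreover have "M (dim_col A) = mat (dim_row A) (dim_col A) (\<lambda>(i, j). f j * A $$ (i, j))"
    by (intro eq_matI) (auto simp: M_def)
  ultimately show ?thesis by simp
qed

subsection \<open>Matroids and spikes\<close>

lemma (in matroid) indep_finite: "indep X \<Longrightarrow> finite X"
  using indep_subset_ground finite_ground finite_subset by blast

lemma (in matroid) augment_to_card:
  assumes "indep A" "indep B" "card A \<le> card B"
  shows "\<exists>C. indep C \<and> A \<subseteq> C \<and> C \<subseteq> A \<union> B \<and> card C = card B"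
  using assms
proof (induction "card B - card A" arbitrary: A)
  case 0
  then show ?case by (intro exI[of _ A]) auto
next
  case (Suc m)
  then have "card A < card B" by linarith
  then obtain z where z: "z \<in> B - A" "indep (insert z A)"
    using indep_augment Suc.prems by blast
  then have "card (insert z A) = card A + 1" using indep_finite[OF Suc.prems(1)] by simp
  then have "m = card B - card (insert z A)" "card (insert z A) \<le> card B"
    using Suc.hyps(2) by linarith+
  then obtain C where "indep C" "insert z A \<subseteq> C" "C \<subseteq> insert z A \<union> B" "card C = card B"
    using Suc.hyps(1) Suc.prems(2) z(2) by blast
  then show ?case using z(1) by (intro exI[of _ C]) auto
qed

lemma (in matroid) rank_attained:
  assumes "X \<subseteq> E"
  obtains Y where "indep Y" "Y \<subseteq> X" "card Y = matroid_rank indep X"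
proof -
  have "finite (card ` {Y. Y \<subseteq> X \<and> indep Y})"
    using finite_subset[OF assms finite_ground] by simp
  moreover have "card ` {Y. Y \<subseteq> X \<and> indep Y} \<noteq> {}" using indep_empty by auto
  ultimately have "matroid_rank indep X \<in> card ` {Y. Y \<subseteq> X \<and> indep Y}"
    unfolding matroid_rank_def by (rule Max_in)
  then show ?thesis using that by auto
qed

lemma (in matroid) indep_card_le_rank:
  assumes "X \<subseteq> E" "indep Y" "Y \<subseteq> X"
  shows "card Y \<le> matroid_rank indep X"
  unfolding matroid_rank_def
  using finite_subset[OF assms(1) finite_ground] assms(2,3) by (intro Max_ge) auto

text \<open>A spike with chosen labels \<open>x i\<close>, \<open>y i\<close> for the two points of the \<open>i\<close>-th line other than
  the tip; exchanging the labels on any set of lines gives another instance.\<close>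

locale labelled_spike = matroid E indep
  for E :: "'e set" and indep +
  fixes n :: nat and t :: 'e and x y :: "nat \<Rightarrow> 'e"
  assumes n_ge: "n \<ge> 3"
    and ground: "E = insert t (x ` {1..n} \<union> y ` {1..n})"
    and distinct_points: "i \<in> {1..n} \<Longrightarrow> x i \<noteq> t \<and> y i \<noteq> t \<and> x i \<noteq> y i"
    and line_dep: "i \<in> {1..n} \<Longrightarrow> \<not> indep {t, x i, y i}"
    and pairs_indep: "i \<in> {1..n} \<Longrightarrow> indep {t, x i} \<and> indep {t, y i} \<and> indep {x i, y i}"
    and rank_lines: "I \<subseteq> {1..n} \<Longrightarrow> I \<noteq> {} \<Longrightarrow> card I \<le> n - 1 \<Longrightarrow>
      \<exists>Y. indep Y \<and> Y \<subseteq> insert t (x ` I \<union> y ` I) \<and> card Y = card I + 1"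
    and card_indep_le: "indep Y \<Longrightarrow> card Y \<le> n"

lemma spike_labelled:
  fixes E :: "'e set"
  assumes "spike n E indep"
  obtains t x y where "labelled_spike E indep n t x y"
proof -
  obtain t and L :: "nat \<Rightarrow> 'e set" where n: "n \<ge> 3" and M: "matroid E indep"
    and E: "E = (\<Union>i \<in> {1..n}. L i)"
    and line: "\<forall>i \<in> {1..n}. three_point_line E indep (L i) \<and> t \<in> L i"
    and rank: "\<forall>k \<in> {1..n - 1}. \<forall>I \<subseteq> {1..n}. card I = k \<longrightarrow>
      matroid_rank indep (\<Union>i \<in> I. L i) = k + 1"
    and "matroid_rank indep (\<Union>i \<in> {1..n}. L i) = n"
    using assms unfolding spike_def by blast
  then have rankE: "matroid_rank indep E = n" by simp
  interpret matroid E indep by (rule M)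
  have "\<exists>a b. L i = {t, a, b} \<and> a \<noteq> t \<and> b \<noteq> t \<and> a \<noteq> b" if "i \<in> {1..n}" for i
  proof -
    have "card (L i) = 3" "t \<in> L i" using line that by (auto simp: three_point_line_def)
    then have "card (L i - {t}) = 2" by simp
    then obtain a b where "L i - {t} = {a, b}" "a \<noteq> b" by (auto simp: card_2_iff)
    moreover from this(1) have "a \<noteq> t" "b \<noteq> t" by blast+
    moreover have "L i = {t, a, b}"
      using insert_Diff[OF \<open>t \<in> L i\<close>] \<open>L i - {t} = {a, b}\<close> by simp
    ultimately show ?thesis by blast
  qed
  then obtain x y where L: "L i = {t, x i, y i}" and
    dist: "x i \<noteq> t \<and> y i \<noteq> t \<and> x i \<noteq> y i" if "i \<in> {1..n}" for i
    by metis
  have unions: "(\<Union>i \<in> I. L i) = insert t (x ` I \<union> y ` I)" if "I \<subseteq> {1..n}" "I \<noteq> {}" for I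
  proof -
    have "(\<Union>i \<in> I. L i) = (\<Union>i \<in> I. {t, x i, y i})"
      using that(1) L by (intro SUP_cong) blast+
    also have "\<dots> = insert t (x ` I \<union> y ` I)" using that(2) by auto
    finally show ?thesis .
  qed
  have "labelled_spike E indep n t x y"
  proof unfold_locales
    show "n \<ge> 3" by (rule n)
    show "E = insert t (x ` {1..n} \<union> y ` {1..n})" using unions[of "{1..n}"] n E by auto
  next
    fix i assume i: "i \<in> {1..n}"
    show "x i \<noteq> t \<and> y i \<noteq> t \<and> x i \<noteq> y i" by (rule dist[OF i])
    have r: "matroid_rank indep (L i) = 2" "\<And>X. X \<subseteq> L i \<Longrightarrow> card X = 2 \<Longrightarrow> indep X"
      using line i by (auto simp: three_point_line_def)
    show "\<not> indep {t, x i, y i}"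
    proof
      assume "indep {t, x i, y i}"
      moreover have "L i \<subseteq> E" using E i by blast
      ultimately have "card (L i) \<le> 2"
        using indep_card_le_rank[of "L i" "L i"] r(1) L[OF i] by simp
      then show False using line i by (simp add: three_point_line_def)
    qed
    show "indep {t, x i} \<and> indep {t, y i} \<and> indep {x i, y i}"
      by (intro conjI r(2)) (use dist[OF i] L[OF i] in \<open>auto simp: card_2_iff\<close>)
  next
    fix I assume I: "I \<subseteq> {1..n}" "I \<noteq> {}" "card I \<le> n - 1"
    have "finite I" using I(1) finite_subset by blast
    then have "card I \<in> {1..n - 1}" using I(2,3) by (simp add: Suc_le_eq card_gt_0_iff)
    moreover have "(\<Union>i \<in> I. L i) \<subseteq> E" using E I(1) by auto
    ultimately show "\<exists>Y. indep Y \<and> Y \<subseteq> insert t (x ` I \<union> y ` I) \<and> card Y = card I + 1"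
      using rank I unions[of I] rank_attained by metis
  next
    fix Y assume "indep Y"
    then show "card Y \<le> n"
      using indep_card_le_rank[of E Y] indep_subset_ground rankE by auto
  qed
  then show ?thesis using that by blast
qed

section \<open>Independence and distinctness of the points of a spike\<close>

context labelled_spike
begin

text \<open>The assumptions treat the two points of each line alike. Facts proved for the points
  \<open>x i\<close> thereby extend to every transversal.\<close>

lemma labelled_spike_swap:
  "labelled_spike E indep n t (\<lambda>i. if i \<in> S then y i else x i) (\<lambda>i. if i \<in> S then x i else y i)"
proof -
  have swap: "insert t ((\<lambda>i. if i \<in> S then y i else x i) ` I \<union>
      (\<lambda>i. if i \<in> S then x i else y i) ` I) = insert t (x ` I \<union> y ` I)" for I
    by (auto split: if_splits)
  show ?thesis
  proof unfold_locales
    show "E = insert t ((\<lambda>i. if i \<in> S then y i else x i) ` {1..n} \<union>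
      (\<lambda>i. if i \<in> S then x i else y i) ` {1..n})" unfolding swap by (rule ground)
  next
    fix i assume i: "i \<in> {1..n}"
    show "(if i \<in> S then y i else x i) \<noteq> t \<and> (if i \<in> S then x i else y i) \<noteq> t \<and>
      (if i \<in> S then y i else x i) \<noteq> (if i \<in> S then x i else y i)"
      using distinct_points[OF i] by auto
    show "\<not> indep {t, if i \<in> S then y i else x i, if i \<in> S then x i else y i}"
      using line_dep[OF i] by (simp add: insert_commute)
    show "indep {t, if i \<in> S then y i else x i} \<and> indep {t, if i \<in> S then x i else y i} \<and>
      indep {if i \<in> S then y i else x i, if i \<in> S then x i else y i}"
      using pairs_indep[OF i] by (simp add: insert_commute)
  next
    fix I assume "I \<subseteq> {1..n}" "I \<noteq> {}" "card I \<le> n - 1"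
    then show "\<exists>Y. indep Y \<and> Y \<subseteq> insert t ((\<lambda>i. if i \<in> S then y i else x i) ` I \<union>
      (\<lambda>i. if i \<in> S then x i else y i) ` I) \<and> card Y = card I + 1"
      unfolding swap by (rule rank_lines)
  qed (fact n_ge, fact card_indep_le)
qed

text \<open>Adding a line raises the rank by one, so the set for \<open>I\<close> can be augmented
  by a point of these lines. That point is on the new line and can be exchanged for
  \<open>x i\<close> if it is \<open>y i\<close>.\<close>

lemma indep_tip_points:
  assumes "I \<subseteq> {1..n}" "card I \<le> n - 1"
  shows "indep (insert t (x ` I)) \<and> card (insert t (x ` I)) = card I + 1"
proof -
  have "finite I" using assms(1) finite_subset by blast
  then show ?thesis using assms
  proof (induction I rule: finite_induct)
    case empty
    have "indep {t}" using pairs_indep[of 1] n_ge by (intro indep_mono[of "{t, x 1}" "{t}"]) auto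
    then show ?case by simp
  next
    case (insert i I)
    define X where "X = insert t (x ` I)"
    have X: "indep X" "card X = card I + 1" using insert by (auto simp: X_def)
    have i: "i \<in> {1..n}" using insert.prems by simp
    obtain Y where Y: "indep Y" "Y \<subseteq> insert t (x ` insert i I \<union> y ` insert i I)"
      "card Y = card I + 2"
      using rank_lines[of "insert i I"] insert by auto
    obtain z where z: "z \<in> Y - X" "indep (insert z X)"
      using indep_augment[OF X(1) Y(1)] X(2) Y(3) by auto
    \<comment> \<open>A point \<open>y j\<close> of an earlier line would complete the dependent
      line \<open>{t, x j, y j}\<close>.\<close>
    have "z = x i \<or> z = y i"
    proof (rule ccontr)
      assume "\<not> ?thesis"
      then obtain j where j: "j \<in> I" "z = y j" using z(1) Y(2) X_def by auto
      then have "{t, x j, y j} \<subseteq> insert z X" by (auto simp: X_def)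
      then show False using line_dep[of j] indep_mono[OF z(2)] j(1) insert.prems by blast
    qed
    then have "indep (insert (x i) X) \<and> card (insert (x i) X) = card I + 2"
    proof
      assume "z = x i"
      then show ?thesis using z X indep_finite[OF X(1)] by simp
    next
      \<comment> \<open>Extend \<open>{t, x i}\<close> to the full size inside
        \<open>insert z X\<close>. The result omits \<open>y i\<close>, as it would otherwise
        contain the whole dependent line, so only \<open>X\<close> and \<open>x i\<close> are left
        to fill it.\<close>
      assume zy: "z = y i"
      have card_z: "card (insert z X) = card I + 2" using z(1) X indep_finite[OF X(1)] by simp
      moreover have "card {t, x i} = 2" using distinct_points[OF i] by (metis card_2_iff)
      ultimately obtain C where C: "indep C" "{t, x i} \<subseteq> C" "C \<subseteq> {t, x i} \<union> insert z X"
        "card C = card I + 2"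
        using augment_to_card[of "{t, x i}" "insert z X"] pairs_indep[OF i] z(2) by auto
      have "\<not> {t, x i, y i} \<subseteq> C" using line_dep[OF i] indep_mono[OF C(1)] by metis
      then have "y i \<notin> C" using C(2) by simp
      then have "C \<subseteq> insert (x i) X" using C(3) zy by (auto simp: X_def)
      moreover have "card (insert (x i) X) \<le> card C"
        using C(4) X indep_finite[OF X(1)] by (simp add: card_insert_if)
      ultimately have "C = insert (x i) X" using indep_finite[OF X(1)] by (intro card_seteq) auto
      then show ?thesis using C by simp
    qed
    then show ?case using insert.hyps by (simp add: X_def insert_commute)
  qed
qed

lemma inj_x: "inj_on x {1..n}"
proof (rule inj_onI, rule ccontr)
  fix i j assume ij: "i \<in> {1..n}" "j \<in> {1..n}" "x i = x j" "i \<noteq> j"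
  then have "card (insert t (x ` {i, j})) = 3" using indep_tip_points[of "{i, j}"] n_ge by simp
  moreover have "card {t, x j} \<le> 2" by (simp add: card_insert_if)
  ultimately show False using ij(3) by simp
qed

lemma inj_transversal: "inj_on (\<lambda>i. if i \<in> S then y i else x i) {1..n}"
  using labelled_spike.inj_x[OF labelled_spike_swap] .

lemma inj_y: "inj_on y {1..n}"
  using inj_transversal[of UNIV] by simp

lemma x_neq_y:
  assumes "i \<in> {1..n}" "j \<in> {1..n}"
  shows "x i \<noteq> y j"
proof (cases "i = j")
  case False
  show ?thesis
  proof
    assume "x i = y j"
    \<comment> \<open>The transversal through \<open>y j\<close> and all other points
      \<open>x i\<close> has distinct points.\<close>
    then have "(if i \<in> {j} then y i else x i) = (if j \<in> {j} then y j else x j)"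
      using False by simp
    then have "i = j" by (rule inj_onD[OF inj_transversal[of "{j}"] _ assms])
    then show False using False by simp
  qed
qed (use distinct_points assms in auto)

text \<open>Numbering the tip as 0 puts a basis of the matroid at the indices below
  \<open>n\<close>.\<close>

definition tip_point :: "nat \<Rightarrow> 'e" where
  "tip_point i = (if i = 0 then t else x i)"

lemma inj_tip_point: "inj_on tip_point {..n}"
proof (rule inj_onI)
  fix i j assume ij: "i \<in> {..n}" "j \<in> {..n}" "tip_point i = tip_point j"
  show "i = j"
    using ij inj_onD[OF inj_x, of i j] distinct_points[of i] distinct_points[of j]
    by (cases "i = 0"; cases "j = 0") (auto simp: tip_point_def)
qed

text \<open>The tip is never the omitted point: the points \<open>x 1, ..., x n\<close> alone may be
  dependent.\<close>

lemma indep_tip_point: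
  assumes i: "i \<in> {1..n}"
  shows "indep (tip_point ` ({..n} - {i}))"
proof -
  have "{..n} - {i} = insert 0 ({1..n} - {i})" using i by auto
  then have "tip_point ` ({..n} - {i}) = insert t (x ` ({1..n} - {i}))"
    by (auto simp: tip_point_def image_def)
  then show ?thesis using indep_tip_points[of "{1..n} - {i}"] i by auto
qed

lemma dep_tip_point: "\<not> indep (tip_point ` {..n})"
  using card_indep_le[of "tip_point ` {..n}"] by (auto simp: card_image[OF inj_tip_point])

section \<open>Normal form of a representation of a spike\<close>

text \<open>Contracting the tip leaves one linear relation among the points \<open>x i\<close>, with all
  coefficients nonzero, and makes \<open>x i\<close> and \<open>y i\<close> parallel.\<close>

definition normal_form ::
  "('e \<Rightarrow> nat \<Rightarrow> 'f :: field) \<Rightarrow> 'f \<Rightarrow> (nat \<Rightarrow> 'f) \<Rightarrow> (nat \<Rightarrow> 'f) \<Rightarrow> (nat \<Rightarrow> 'f) \<Rightarrow> bool"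
where
  "normal_form v a b c s \<longleftrightarrow>
     (\<forall>i\<in>{1..n}. b i \<noteq> 0 \<and> c i \<noteq> 0 \<and> s i \<noteq> 0) \<and>
     (\<forall>k. (\<Sum>i = 1..n. c i * v (x i) k) = a * v t k) \<and>
     (\<forall>i\<in>{1..n}. \<forall>k. s i * v (y i) k = c i * v (x i) k + b i * v t k)"

text \<open>The three points of a line are dependent but any two are independent, so a nontrivial
  relation has no zero coefficient and can be solved for \<open>y i\<close>.\<close>

lemma line_relation:
  fixes v :: "'e \<Rightarrow> nat \<Rightarrow> 'f :: field"
  assumes rep: "\<And>X. indep X \<longleftrightarrow> X \<subseteq> E \<and> lin_indep v X" and i: "i \<in> {1..n}"
  shows "\<exists>q p. q \<noteq> 0 \<and> p \<noteq> 0 \<and> (\<forall>k. v (y i) k = q * v (x i) k + p * v t k)"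
proof -
  note d = distinct_points[OF i]
  have "{t, x i, y i} \<subseteq> E" using ground i by auto
  then have "\<not> lin_indep v {t, x i, y i}" using rep line_dep[OF i] by blast
  then obtain p q r where pqr: "p \<noteq> 0 \<or> q \<noteq> 0 \<or> r \<noteq> 0"
    "\<And>k. p * v t k + q * v (x i) k + r * v (y i) k = 0"
    using not_lin_indep_tripleE[of v t "x i" "y i"] d by metis
  have ind: "lin_indep v {t, x i}" "lin_indep v {t, y i}" "lin_indep v {x i, y i}"
    using pairs_indep[OF i] rep by auto
  have r: "r \<noteq> 0" using lin_indep_pairD[OF ind(1), of p q] pqr d by auto
  have q: "q \<noteq> 0" using lin_indep_pairD[OF ind(2), of p r] pqr d by auto
  have p: "p \<noteq> 0" using lin_indep_pairD[OF ind(3), of q r] pqr d by auto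
  have "v (y i) k = (- q / r) * v (x i) k + (- p / r) * v t k" for k
  proof -
    have "r * v (y i) k = - (p * v t k + q * v (x i) k)"
      using pqr(2)[of k] by (simp only: add_eq_0_iff)
    then have "v (y i) k = - (p * v t k + q * v (x i) k) / r"
      using r by (metis nonzero_mult_div_cancel_left)
    then show ?thesis by (simp add: add_divide_distrib diff_divide_distrib)
  qed
  then show ?thesis using p q r by (intro exI[of _ "- q / r"] exI[of _ "- p / r"]) auto
qed

text \<open>The tip and the points \<open>x i\<close> are dependent, but no longer so without a
  single \<open>x i\<close>; hence each \<open>x i\<close> has a nonzero coefficient. The
  coefficient of the tip may vanish.\<close>

lemma normal_form_exists:
  fixes v :: "'e \<Rightarrow> nat \<Rightarrow> 'f :: field"
  assumes rep: "\<And>X. indep X \<longleftrightarrow> X \<subseteq> E \<and> lin_indep v X"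
  obtains a b c s where "normal_form v a b c s"
proof -
  obtain q p where qp: "\<forall>i\<in>{1..n}. q i \<noteq> 0 \<and> p i \<noteq> 0 \<and>
      (\<forall>k. v (y i) k = q i * v (x i) k + p i * v t k)"
    using line_relation[OF rep] by metis
  have "tip_point ` {..n} \<subseteq> E" using ground by (auto simp: tip_point_def)
  then have "\<not> lin_indep v (tip_point ` {..n})" using rep dep_tip_point by blast
  then obtain d where d: "\<And>k. (\<Sum>i\<le>n. d i * v (tip_point i) k) = 0" "\<exists>i\<in>{..n}. d i \<noteq> 0"
    unfolding lin_indep_image_iff[OF inj_tip_point] by blast
  have nz: "d i \<noteq> 0" if i: "i \<in> {1..n}" for i
  proof
    assume "d i = 0"
    then have "(\<Sum>j\<in>{..n} - {i}. d j * v (tip_point j) k) = 0" for k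
      using d(1)[of k] i sum.remove[of "{..n}" i "\<lambda>j. d j * v (tip_point j) k"] by simp
    moreover have "lin_indep v (tip_point ` ({..n} - {i}))" using indep_tip_point[OF i] rep by blast
    ultimately have "\<forall>j\<in>{..n} - {i}. d j = 0"
      using lin_indep_image_iff[OF inj_on_subset[OF inj_tip_point, of "{..n} - {i}"], of v] by blast
    then show False using d(2) \<open>d i = 0\<close> by auto
  qed
  have "(\<Sum>i = 1..n. d i * v (x i) k) = - d 0 * v t k" for k
  proof -
    have "{..n} = insert 0 {1..n}" by auto
    then have "(\<Sum>i\<le>n. d i * v (tip_point i) k) = d 0 * v t k + (\<Sum>i = 1..n. d i * v (x i) k)"
      by (simp add: tip_point_def)
    then show ?thesis using d(1)[of k] by (simp add: add_eq_0_iff)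
  qed
  \<comment> \<open>The parameters arise by multiplying the line relation by
    \<open>d i / q i\<close>, which gives \<open>x i\<close> the coefficient
    \<open>d i\<close>.\<close>
  then have "normal_form v (- d 0) (\<lambda>i. d i * p i / q i) d (\<lambda>i. d i / q i)"
    unfolding normal_form_def using nz qp by (auto simp: field_simps)
  then show ?thesis using that by blast
qed

text \<open>The points of the transversal, scaled by \<open>w\<close>, add up to
  \<open>a + sum b S\<close> times the tip. Up to a factor this is the only possible dependence
  among them.\<close>

lemma indep_transversal_iff:
  fixes v :: "'e \<Rightarrow> nat \<Rightarrow> 'f :: field"
  assumes rep: "\<And>X. indep X \<longleftrightarrow> X \<subseteq> E \<and> lin_indep v X"
    and nf: "normal_form v a b c s" and S: "S \<subseteq> {1..n}"
  shows "indep ((\<lambda>i. if i \<in> S then y i else x i) ` {1..n}) \<longleftrightarrow> a + sum b S \<noteq> 0"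
proof -
  define z where "z i = (if i \<in> S then y i else x i)" for i
  define w where "w i = (if i \<in> S then s i else c i)" for i
  have nz: "w i \<noteq> 0" "c i \<noteq> 0" if "i \<in> {1..n}" for i
    using nf that by (auto simp: normal_form_def w_def)
  have rel: "(\<Sum>i = 1..n. c i * v (x i) k) = a * v t k" for k
    using nf by (auto simp: normal_form_def)
  have wz: "w i * v (z i) k = c i * v (x i) k + (if i \<in> S then b i else 0) * v t k"
    if "i \<in> {1..n}" for i k
    using nf that by (auto simp: normal_form_def w_def z_def)
  have sum_S: "(\<Sum>i = 1..n. if i \<in> S then f i else 0) = sum f S" for f :: "nat \<Rightarrow> 'f"
    using S by (simp add: sum.inter_restrict[symmetric] Int_absorb1)
  have "z ` {1..n} \<subseteq> E" using ground by (auto simp: z_def)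
  then have "indep (z ` {1..n}) \<longleftrightarrow> lin_indep v (z ` {1..n})" using rep by blast
  also have "\<dots> \<longleftrightarrow> (\<forall>d. (\<forall>k. (\<Sum>i = 1..n. d i * v (z i) k) = 0) \<longrightarrow> (\<forall>i\<in>{1..n}. d i = 0))"
    using lin_indep_image_iff[OF inj_transversal[of S]] by (simp add: z_def)
  also have "\<dots> \<longleftrightarrow> a + sum b S \<noteq> 0"
  proof
    assume ind: "\<forall>d. (\<forall>k. (\<Sum>i = 1..n. d i * v (z i) k) = 0) \<longrightarrow> (\<forall>i\<in>{1..n}. d i = 0)"
    show "a + sum b S \<noteq> 0"
    proof
      assume zero: "a + sum b S = 0"
      have "(\<Sum>i = 1..n. w i * v (z i) k) = 0" for k
      proof -
        have "(\<Sum>i = 1..n. w i * v (z i) k) =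
            (\<Sum>i = 1..n. c i * v (x i) k + (if i \<in> S then b i else 0) * v t k)"
          by (rule sum.cong[OF HOL.refl wz])
        also have "\<dots> = (a + sum b S) * v t k"
          unfolding sum.distrib sum_distrib_right[symmetric] sum_S rel by (simp add: distrib_right)
        finally have "(\<Sum>i = 1..n. w i * v (z i) k) = (a + sum b S) * v t k" .
        then show ?thesis using zero by simp
      qed
      then have "\<forall>i\<in>{1..n}. w i = 0" using ind by blast
      then have "w 1 = 0" using n_ge by simp
      then show False using nz(1)[of 1] n_ge by simp
    qed
  next
    assume nonzero: "a + sum b S \<noteq> 0"
    show "\<forall>d. (\<forall>k. (\<Sum>i = 1..n. d i * v (z i) k) = 0) \<longrightarrow> (\<forall>i\<in>{1..n}. d i = 0)"
    proof (intro allI impI)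
      fix d assume d: "\<forall>k. (\<Sum>i = 1..n. d i * v (z i) k) = 0"
      \<comment> \<open>The relation is expressed in the points scaled by \<open>w\<close>, then in
        \<open>t\<close> and the \<open>x i\<close>. Subtracting \<open>e n\<close> times the
        relation among the \<open>x i\<close> removes \<open>x n\<close>, so that
        \<open>g n = 0\<close> and \<open>g\<close> lists coefficients over an independent family.
        Their vanishing makes all \<open>e i\<close> equal.\<close>
      define e where "e i = d i / w i" for i
      define g where "g i = (if i = 0 then (\<Sum>i\<in>S. e i * b i) + e n * a else (e i - e n) * c i)"
        for i
      have split_n: "{..n} = insert 0 {1..n}" by auto
      have "(\<Sum>i\<in>{..n} - {n}. g i * v (tip_point i) k) = 0" for k
      proof -
        have "(\<Sum>i\<in>{..n} - {n}. g i * v (tip_point i) k) = (\<Sum>i\<le>n. g i * v (tip_point i) k)"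
          using n_ge by (intro sum.mono_neutral_left) (auto simp: g_def)
        also have "\<dots> = ((\<Sum>i\<in>S. e i * b i) + e n * a) * v t k +
            (\<Sum>i = 1..n. (e i - e n) * c i * v (x i) k)"
          unfolding split_n by (simp add: g_def tip_point_def)
        also have "(\<Sum>i = 1..n. (e i - e n) * c i * v (x i) k) =
            (\<Sum>i = 1..n. e i * (c i * v (x i) k)) - e n * (a * v t k)"
          unfolding rel[symmetric] by (simp add: algebra_simps sum_subtractf sum_distrib_left)
        also have "(\<Sum>i = 1..n. e i * (c i * v (x i) k)) =
            (\<Sum>i = 1..n. d i * v (z i) k - (if i \<in> S then e i * b i else 0) * v t k)"
        proof (intro sum.cong HOL.refl)
          fix i assume i: "i \<in> {1..n}"
          have "d i * v (z i) k = e i * (w i * v (z i) k)" using nz(1)[OF i] by (simp add: e_def)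
          then show "e i * (c i * v (x i) k) =
              d i * v (z i) k - (if i \<in> S then e i * b i else 0) * v t k"
            using wz[OF i, of k] by (simp add: algebra_simps)
        qed
        also have "\<dots> = - (\<Sum>i\<in>S. e i * b i) * v t k"
          unfolding sum_subtractf sum_distrib_right[symmetric] sum_S using d by simp
        finally show ?thesis by (simp add: algebra_simps)
      qed
      moreover have "lin_indep v (tip_point ` ({..n} - {n}))"
        using indep_tip_point[of n] n_ge rep by auto
      ultimately have g: "\<forall>i\<in>{..n} - {n}. g i = 0"
        using lin_indep_image_iff[OF inj_on_subset[OF inj_tip_point, of "{..n} - {n}"], of v]
        by blast
      have e: "e i = e n" if "i \<in> {1..n}" for i
        using bspec[OF g, of i] that nz(2)[OF that] by (cases "i = n") (auto simp: g_def)
      have "(\<Sum>i\<in>S. e i * b i) = e n * sum b S"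
        unfolding sum_distrib_left using S e by (intro sum.cong) (simp, metis subsetD)
      moreover have "g 0 = 0" using g n_ge by auto
      ultimately have "e n * (a + sum b S) = 0" by (simp add: g_def algebra_simps)
      then have "e n = 0" using nonzero by simp
      then show "\<forall>i\<in>{1..n}. d i = 0" using e nz(1) by (auto simp: e_def)
    qed
  qed
  finally show ?thesis by (simp add: z_def)
qed

text \<open>The coordinates are chosen before the family \<open>u\<close>: they depend on the
  parameters only, so two families with the same normal form share them.\<close>

lemma normal_form_coordinates:
  fixes a :: "'f :: field"
  assumes "e \<in> E"
  shows "\<exists>d. \<forall>u. normal_form u a b c s \<longrightarrow> (\<forall>k. u e k = (\<Sum>q<n. d q * u (tip_point q) k))"
proof -
  define coord where "coord e d \<longleftrightarrow>
    (\<forall>u. normal_form u a b c s \<longrightarrow> (\<forall>k. u e k = (\<Sum>q<n. d q * u (tip_point q) k)))"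
    for e and d :: "nat \<Rightarrow> 'f"
  show ?thesis
  \<comment> \<open>Some family in normal form is what shows that \<open>c i\<close> and
    \<open>s i\<close> are nonzero; otherwise the claim is vacuous.\<close>
  proof (cases "\<exists>u. normal_form u a b c s")
    case True
    then have nz: "c i \<noteq> 0" "s i \<noteq> 0" if "i \<in> {1..n}" for i
      using that by (auto simp: normal_form_def)
    have basis: "coord (tip_point i) (\<lambda>q. if q = i then 1 else 0)" if "i < n" for i
      unfolding coord_def using that by (auto simp: if_distrib[of "\<lambda>r. r * _"] cong: if_cong)
    then have coord_t: "coord t (\<lambda>q. if q = 0 then 1 else 0)"
      using n_ge by (metis tip_point_def less_le_trans zero_less_numeral)
    have coord_x: "\<exists>d. coord (x i) d" if i: "i \<in> {1..n}" for i
    proof (cases "i = n")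
      case True
      \<comment> \<open>Obtained by solving the relation among the \<open>x i\<close> for
        \<open>x n\<close>.\<close>
      define d where "d q = (if q = 0 then a else - c q) / c n" for q
      have "u (x n) k = (\<Sum>q<n. d q * u (tip_point q) k)" if u: "normal_form u a b c s" for u k
      proof -
        have "(\<Sum>q<n. d q * u (tip_point q) k) = d 0 * u t k + (\<Sum>i\<in>{1..<n}. d i * u (x i) k)"
        proof -
          have "{..<n} = insert 0 {1..<n}" using n_ge by auto
          then show ?thesis by (simp add: tip_point_def)
        qed
        also have "(\<Sum>i\<in>{1..<n}. d i * u (x i) k) = - (\<Sum>i\<in>{1..<n}. c i * u (x i) k) / c n"
          unfolding sum_negf[symmetric] sum_divide_distrib by (intro sum.cong) (auto simp: d_def)
        finally have sum_d: "(\<Sum>q<n. d q * u (tip_point q) k) =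
            d 0 * u t k - (\<Sum>i\<in>{1..<n}. c i * u (x i) k) / c n" by simp
        have "{1..n} = insert n {1..<n}" using n_ge by auto
        then have "a * u t k = c n * u (x n) k + (\<Sum>i\<in>{1..<n}. c i * u (x i) k)"
          using u by (simp add: normal_form_def)
        then show ?thesis
          unfolding sum_d using nz(1)[OF i] True by (simp add: d_def field_simps)
      qed
      then show ?thesis using True by (auto simp: coord_def)
    next
      case False
      then show ?thesis using basis[of i] i by (auto simp: tip_point_def)
    qed
    have "\<exists>d. coord (y i) d" if i: "i \<in> {1..n}" for i
    proof -
      obtain d where d: "coord (x i) d" using coord_x[OF i] by blast
      have "coord (y i) (\<lambda>q. (c i * d q + b i * (if q = 0 then 1 else 0)) / s i)"
        unfolding coord_def
      proof (intro allI impI)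
        fix u k assume u: "normal_form u a b c s"
        have "s i * u (y i) k = c i * u (x i) k + b i * u t k"
          using u i by (auto simp: normal_form_def)
        also have "\<dots> = c i * (\<Sum>q<n. d q * u (tip_point q) k) +
            b i * (\<Sum>q<n. (if q = 0 then 1 else 0) * u (tip_point q) k)"
          using d coord_t u by (simp add: coord_def)
        also have "\<dots> = (\<Sum>q<n. (c i * d q + b i * (if q = 0 then 1 else 0)) * u (tip_point q) k)"
          unfolding sum_distrib_left sum.distrib[symmetric]
          by (intro sum.cong) (auto simp: algebra_simps)
        finally have "u (y i) k =
            (\<Sum>q<n. (c i * d q + b i * (if q = 0 then 1 else 0)) * u (tip_point q) k) / s i"
          using nz(2)[OF i] by (simp add: field_simps)
        then show "u (y i) k =
            (\<Sum>q<n. (c i * d q + b i * (if q = 0 then 1 else 0)) / s i * u (tip_point q) k)"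
          by (simp add: sum_divide_distrib)
      qed
      then show ?thesis by blast
    qed
    then have "\<exists>d. coord e d" using assms ground coord_t coord_x by auto
    then show ?thesis by (simp add: coord_def)
  qed auto
qed

section \<open>Comparison of two representations with proportional parameters\<close>

lemma normal_form_rescale:
  fixes v :: "'e \<Rightarrow> nat \<Rightarrow> 'f :: field"
  assumes v: "normal_form v a b c s" and w: "normal_form w a' b' c' s'"
    and r: "r \<noteq> 0" "a' = r * a" "\<And>i. i \<in> {1..n} \<Longrightarrow> b' i = r * b i"
  obtains f where "\<And>e. f e \<noteq> 0" "normal_form (\<lambda>e k. f e * v e k) a' b' c' s'"
proof -
  \<comment> \<open>The factors turn \<open>c\<close> into \<open>c'\<close> and \<open>s\<close>
    into \<open>s'\<close>, and scaling the tip by \<open>1 / r\<close> absorbs the ratio of the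
    other parameters. The last branch also keeps \<open>f\<close> nonzero off the ground
    set.\<close>
  define f where "f e = (if e \<in> x ` {1..n} then
      c (inv_into {1..n} x e) / c' (inv_into {1..n} x e)
    else if e \<in> y ` {1..n} then s (inv_into {1..n} y e) / s' (inv_into {1..n} y e)
    else 1 / r)" for e
  have nz: "c i \<noteq> 0" "s i \<noteq> 0" "c' i \<noteq> 0" "s' i \<noteq> 0" if "i \<in> {1..n}" for i
    using v w that by (auto simp: normal_form_def)
  have "f e \<noteq> 0" for e
    using nz[OF inv_into_into[of e x "{1..n}"]] nz[OF inv_into_into[of e y "{1..n}"]] r(1)
    by (simp add: f_def)
  moreover have fx: "f (x i) = c i / c' i" if "i \<in> {1..n}" for i
    using that by (simp add: f_def inv_into_f_f[OF inj_x] del: One_nat_def)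
  have fy: "f (y i) = s i / s' i" if "i \<in> {1..n}" for i
  proof -
    have "y i \<notin> x ` {1..n}" using x_neq_y that by fastforce
    then show ?thesis using that by (simp add: f_def inv_into_f_f[OF inj_y] del: One_nat_def)
  qed
  have "t \<notin> x ` {1..n}" "t \<notin> y ` {1..n}" using distinct_points by force+
  then have ft: "f t = 1 / r" by (simp add: f_def)
  have cx: "c' i * (f (x i) * v (x i) k) = c i * v (x i) k"
    and sy: "s' i * (f (y i) * v (y i) k) = s i * v (y i) k" if "i \<in> {1..n}" for i k
    using nz[OF that] by (simp_all add: fx[OF that] fy[OF that])
  have "normal_form (\<lambda>e k. f e * v e k) a' b' c' s'"
    unfolding normal_form_def
  proof (intro conjI ballI allI)
    fix k
    have "(\<Sum>i = 1..n. c' i * (f (x i) * v (x i) k)) = (\<Sum>i = 1..n. c i * v (x i) k)"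
      by (intro sum.cong HOL.refl cx)
    then show "(\<Sum>i = 1..n. c' i * (f (x i) * v (x i) k)) = a' * (f t * v t k)"
      using v r by (simp add: normal_form_def ft)
  next
    fix i k assume i: "i \<in> {1..n}"
    show "s' i * (f (y i) * v (y i) k) = c' i * (f (x i) * v (x i) k) + b' i * (f t * v t k)"
      using v i r(1) r(3)[OF i] by (simp add: cx sy normal_form_def ft)
  qed (use w in \<open>auto simp: normal_form_def\<close>)
  ultimately show ?thesis using that by blast
qed

text \<open>Both sides express dependence of the same transversal, a property of the matroid and not
  of the field.\<close>

lemma zero_sums_eq:
  fixes v :: "'e \<Rightarrow> nat \<Rightarrow> 'f :: field" and w :: "'e \<Rightarrow> nat \<Rightarrow> 'k :: field"
  assumes "\<And>X. indep X \<longleftrightarrow> X \<subseteq> E \<and> lin_indep v X" "normal_form v a b c s"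
    and "\<And>X. indep X \<longleftrightarrow> X \<subseteq> E \<and> lin_indep w X" "normal_form w a' b' c' s'"
    and "S \<subseteq> {1..n}"
  shows "a + sum b S = 0 \<longleftrightarrow> a' + sum b' S = 0"
  using indep_transversal_iff[OF assms(1,2,5)] indep_transversal_iff[OF assms(3,4,5)] by blast

text \<open>Column scaling gives \<open>A\<close> the parameters of \<open>B\<close>. All columns
  then have equal coordinates over the basis \<open>tip_point\<close>, so row operations finish the
  proof.\<close>

lemma equivalent_mat_if_proportional:
  fixes A B :: "'f :: field mat"
  assumes A: "represents A es E indep" and B: "represents B es E indep"
    and dim: "dim_row A = dim_row B"
    and nfA: "normal_form (element_column A es) a b c s"
    and nfB: "normal_form (element_column B es) a' b' c' s'"
    and r: "r \<noteq> 0" "a' = r * a" "\<And>i. i \<in> {1..n} \<Longrightarrow> b' i = r * b i"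
  shows "equivalent_mat A B"
proof -
  define v where "v = element_column A es"
  define w where "w = element_column B es"
  have es: "distinct es" "set es = E" "dim_col A = length es" "dim_col B = length es"
    using A B by (auto simp: represents_def)
  have inj: "inj_on ((!) es) {..<length es}" using es(1) by (simp add: inj_on_nth)
  have image: "(!) es ` {..<length es} = E" using es(2) by (auto simp: set_conv_nth)
  define idx where "idx = inv_into {..<length es} ((!) es)"
  have idx: "idx e < length es" "es ! idx e = e" if "e \<in> E" for e
    using that image inv_into_into[of e "(!) es" "{..<length es}"]
      f_inv_into_f[of e "(!) es" "{..<length es}"] by (auto simp: idx_def)
  have idx_nth: "idx (es ! k) = k" if "k < length es" for k
    using that by (simp add: idx_def inv_into_f_f[OF inj])
  have inj_idx: "inj_on idx E" using idx(2) by (rule inj_on_inverseI)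
  obtain f where f: "\<And>e. f e \<noteq> 0" and nf: "normal_form (\<lambda>e k. f e * v e k) a' b' c' s'"
    using normal_form_rescale[OF nfA nfB r] unfolding v_def by blast
  define M where "M = mat (dim_row A) (dim_col A) (\<lambda>(i, j). f (es ! j) * A $$ (i, j))"
  have "equivalent_mat A M" unfolding M_def by (rule equivalent_mat_scale_cols) (rule f)
  have dimM: "dim_row M = dim_row B" "dim_col M = dim_col B" "dim_col M = length es"
    using dim es by (auto simp: M_def)
  have colM: "column M (idx e) k = f e * v e k" and colB: "column B (idx e) k = w e k"
    if e: "e \<in> E" for e k
    using idx[OF e] es by (auto simp: M_def column_def v_def w_def element_column_def idx_def)
  have basis_E: "tip_point ` {..<n} \<subseteq> E" using ground by (auto simp: tip_point_def)
  have "{..n} - {n} = {..<n}" by auto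
  then have ind: "indep (tip_point ` {..<n})" using indep_tip_point[of n] n_ge by simp
  have inj_b: "inj_on tip_point {..<n}" using inj_tip_point by (rule inj_on_subset) auto
  \<comment> \<open>Carries independence of the basis from elements to column positions.\<close>
  have lin: "lin_indep C ((idx \<circ> tip_point) ` {..<n})"
    if "\<And>e k. e \<in> E \<Longrightarrow> C (idx e) k = u e k" "lin_indep u (tip_point ` {..<n})"
    for C u :: "_ \<Rightarrow> nat \<Rightarrow> 'f"
  proof -
    have "lin_indep C (idx ` tip_point ` {..<n}) \<longleftrightarrow> lin_indep (C \<circ> idx) (tip_point ` {..<n})"
      by (rule lin_indep_reindex[OF inj_on_subset[OF inj_idx basis_E]])
    also have "\<dots> \<longleftrightarrow> lin_indep u (tip_point ` {..<n})"
      using that(1) basis_E by (intro lin_indep_cong) auto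
    finally show ?thesis using that(2) by (simp add: image_comp)
  qed
  have "row_equiv M B"
  proof (rule same_coordinates_imp_row_equiv[OF dimM(1,2)])
    show "(idx \<circ> tip_point) ` {..<n} \<subseteq> {..<dim_col M}"
      using basis_E idx(1) dimM(3) by auto
    show "inj_on (idx \<circ> tip_point) {..<n}"
      using inj_b inj_on_subset[OF inj_idx basis_E] by (rule comp_inj_on)
    have "lin_indep v (tip_point ` {..<n})"
      using ind represents_indep_iff[OF A] by (simp add: v_def)
    then have "lin_indep (\<lambda>e k. f e * v e k) (tip_point ` {..<n})"
      using f by (rule lin_indep_scale)
    then show "lin_indep (column M) ((idx \<circ> tip_point) ` {..<n})"
      by (intro lin[of "column M" "\<lambda>e k. f e * v e k"] colM)
    have "lin_indep w (tip_point ` {..<n})"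
      using ind represents_indep_iff[OF B] by (simp add: w_def)
    then show "lin_indep (column B) ((idx \<circ> tip_point) ` {..<n})"
      by (intro lin[of "column B" w] colB)
  next
    fix k assume "k < dim_col M"
    then have k: "k < length es" using dimM(3) by simp
    define e where "e = es ! k"
    have e: "e \<in> E" "k = idx e" using k image idx_nth by (auto simp: e_def)
    obtain d where d: "\<forall>u. normal_form u a' b' c' s' \<longrightarrow>
        (\<forall>k. u e k = (\<Sum>q<n. d q * u (tip_point q) k))"
      using normal_form_coordinates[OF e(1), of a' b' c' s'] by blast
    have tip: "tip_point q \<in> E" if "q < n" for q using that basis_E by auto
    have "column M k i = (\<Sum>q<n. d q * column M ((idx \<circ> tip_point) q) i)" for i
      using mp[OF spec[OF d] nf] e tip by (simp add: colM)
    moreover have "column B k i = (\<Sum>q<n. d q * column B ((idx \<circ> tip_point) q) i)" for i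
      using mp[OF spec[OF d] nfB] e tip by (simp add: colB w_def)
    ultimately show "\<exists>d. \<forall>i. column M k i = (\<Sum>q<n. d q * column M ((idx \<circ> tip_point) q) i) \<and>
        column B k i = (\<Sum>q<n. d q * column B ((idx \<circ> tip_point) q) i)" by blast
  qed
  then show ?thesis using \<open>equivalent_mat A M\<close> by (rule row_equiv_imp_equivalent_mat)
qed

end

theorem mainTheorem1:
  fixes p n :: nat and E :: "'e set" and indep :: "'e set \<Rightarrow> bool"
  assumes "prime p" and "n \<ge> 2 * p - 1"
    and "spike n E indep"
    and "CARD('g :: field) = p"
    and "representable TYPE('g) E indep"
  shows "(representable TYPE('k :: field) E indep \<longrightarrow> CHAR('k) = p) \<and>
         uniquely_representable TYPE('g) E indep"
proof -
  obtain t x y where "labelled_spike E indep n t x y"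
    using spike_labelled[OF assms(3)] by blast
  then interpret labelled_spike E indep n t x y .
  have p: "prime CARD('g)" and N: "finite {1..n}" "card {1..n} \<ge> 2 * CARD('g) - 1"
    using assms(1,2,4) by auto
  have "CHAR('k) = p" if K: "representable TYPE('k) E indep"
  proof -
    obtain A :: "'g mat" and es where A: "represents A es E indep"
      using assms(5) by (auto simp: representable_def)
    obtain B :: "'k mat" and fs where B: "represents B fs E indep"
      using K by (auto simp: representable_def)
    note repA = represents_indep_iff[OF A] and repB = represents_indep_iff[OF B]
    obtain a b c s where nfA: "normal_form (element_column A es) a b c s"
      using normal_form_exists[OF repA] by blast
    obtain a' b' c' s' where nfB: "normal_form (element_column B fs) a' b' c' s'"
      using normal_form_exists[OF repB] by blast
    have "CHAR('k) = CARD('g)"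
    proof (rule zero_sums_imp_CHAR[OF p N])
      show "b i \<noteq> 0" "b' i \<noteq> 0" if "i \<in> {1..n}" for i
        using nfA nfB that by (auto simp: normal_form_def)
      show "a + sum b S = 0 \<longleftrightarrow> a' + sum b' S = 0" if "S \<subseteq> {1..n}" for S
        by (rule zero_sums_eq[OF repA nfA repB nfB that])
    qed
    then show ?thesis using assms(4) by simp
  qed
  moreover have "uniquely_representable TYPE('g) E indep"
    unfolding uniquely_representable_def
  proof (intro allI impI)
    fix A B :: "'g mat" and es
    assume "represents A es E indep" and B: "represents B es E indep"
      and dim: "dim_row A \<le> dim_row B"
    \<comment> \<open>Padding equalizes the row counts and leaves the column matroid
      unchanged.\<close>
    define A' where "A' = A @\<^sub>r 0\<^sub>m (dim_row B - dim_row A) (dim_col A)"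
    have A': "represents A' es E indep"
      unfolding A'_def using \<open>represents A es E indep\<close> by (rule represents_append_zero_rows)
    have dimA': "dim_row A' = dim_row B" using dim by (simp add: A'_def append_rows_def)
    note repA = represents_indep_iff[OF A'] and repB = represents_indep_iff[OF B]
    obtain a b c s where nfA: "normal_form (element_column A' es) a b c s"
      using normal_form_exists[OF repA] by blast
    obtain a' b' c' s' where nfB: "normal_form (element_column B es) a' b' c' s'"
      using normal_form_exists[OF repB] by blast
    have b: "b i \<noteq> 0" "b' i \<noteq> 0" if "i \<in> {1..n}" for i
      using nfA nfB that by (auto simp: normal_form_def)
    obtain r where "r \<noteq> 0" "a' = r * a" "\<And>i. i \<in> {1..n} \<Longrightarrow> b' i = r * b i"
      using zero_sums_imp_proportional[OF p N b zero_sums_eq[OF repA nfA repB nfB]] by blast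
    then show "equivalent_mat (A @\<^sub>r 0\<^sub>m (dim_row B - dim_row A) (dim_col A)) B"
      using equivalent_mat_if_proportional[OF A' B dimA' nfA nfB] unfolding A'_def by blast
  qed
  ultimately show ?thesis by blast
qed

end
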